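(* Let $\mathcal C,\mathcal C'$ be humorous categories and $a\colon\mathcal C\to\mathcal C'$ a full and essentially surjective ($\Bbbk$-linear) functor which commutes with grading shifts and dualities. If $\mathcal C$ is mixed, then so is $\mathcal C'$. In this case, each orthodox basis vector of $K^0(\mathcal C')$ is the image of a unique orthodox basis vector of $K^0(\mathcal C)$ under the induced map $[a]\colon K^0(\mathcal C)\to K^0(\mathcal C')$, and every other orthodox basis vector of $K^0(\mathcal C)$ is sent to $0$. Put differently, the orthodox basis of $K^0(\mathcal C')$, together with a suitable number of zeros, is the image of the orthodox basis of $K^0(\mathcal C)$.
   Context: Fix a field $\Bbbk$. A humorous category is an additive $\Bbbk$-linear Krull–Schmidt category $\mathcal C$ with: an invertible grading shift functor $(1)$ such that the induced $\mathbb Z$-action on isomorphism classes of indecomposables is free with finitely many orbits (the set of orbits is denoted $C$); and a duality (contravariant) functor $M\mapsto M^\circledast$ with $(M(1))^\circledast\cong M^\circledast(-1)$ and with a unique fixed point $P_c\cong P_c^\circledast$ on each orbit $c\in C$; such that $\operatorname{Hom}(M,N(i))=0$ for $i\ll0$, $\dim\operatorname{Hom}(M,N)<\infty$ for all $M,N$, and the local ring $\operatorname{Hom}(P_c,P_c)$ has residue field $\Bbbk$ for all $c$. $K^0$ is the split Grothendieck group, a $\mathbb Z[q,q^{-1}]$-module by $q[M]=[M(1)]$. The orthodox basis of $K^0(\mathcal C)$ is $\{[P_c]\}_{c\in C}$. $\mathcal C$ is mixed if there is a weight function $\operatorname{wt}$ from indecomposable objects to $\mathbb Z$ with $\operatorname{wt}(M(1))=\operatorname{wt}(M)+1$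 and $\operatorname{wt}(M^\circledast)=-\operatorname{wt}(M)$, such that for indecomposable $M,N$: $\operatorname{Hom}(M,N)=0$ whenever $\operatorname{wt}(N)<\operatorname{wt}(M)$, or $M\not\cong N$ and $\operatorname{wt}(N)=\operatorname{wt}(M)$; and $\operatorname{Hom}(M,M)\cong\Bbbk$. *)

theory Defs
  imports
    "Jordan_Normal_Form.Missing_VectorSpace"
    "HOL-Algebra.Free_Abelian_Groups"
    "HOL-Algebra.QuotRing"
    "HOL-Algebra.Generated_Groups"
    "HOL-Library.Multiset"
begin

section \<open>Linear categories\<close>

text \<open>
  \<open>Hom C M N\<close> is the vector space of morphisms \<open>M \<rightarrow> N\<close>; only the vector space fields of the
  record are used. \<open>Comp C M N P g f\<close> is the composite of \<open>f : M \<rightarrow> N\<close> followed by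
  \<open>g : N \<rightarrow> P\<close>. As the operations carry their objects as arguments, the carriers of distinct
  morphism spaces may overlap.
\<close>

record ('o, 'm, 'k) category_data =
  Obj :: "'o set"
  Hom :: "'o \<Rightarrow> 'o \<Rightarrow> ('k, 'm) module"
  Comp :: "'o \<Rightarrow> 'o \<Rightarrow> 'o \<Rightarrow> 'm \<Rightarrow> 'm \<Rightarrow> 'm"
  Idt :: "'o \<Rightarrow> 'm"

locale linear_category =
  fixes K :: "'k ring" and C :: "('o, 'm, 'k, 'z) category_data_scheme"
  assumes field_K: "field K"
    and vectorspace_Hom: "\<lbrakk>M \<in> Obj C; N \<in> Obj C\<rbrakk> \<Longrightarrow> vectorspace K (Hom C M N)"
    and Idt_closed: "M \<in> Obj C \<Longrightarrow> Idt C M \<in> carrier (Hom C M M)"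
    and Comp_linear_left: "\<lbrakk>M \<in> Obj C; N \<in> Obj C; P \<in> Obj C; f \<in> carrier (Hom C M N)\<rbrakk>
      \<Longrightarrow> linear_map K (Hom C N P) (Hom C M P) (\<lambda>g. Comp C M N P g f)"
    and Comp_linear_right: "\<lbrakk>M \<in> Obj C; N \<in> Obj C; P \<in> Obj C; g \<in> carrier (Hom C N P)\<rbrakk>
      \<Longrightarrow> linear_map K (Hom C M N) (Hom C M P) (\<lambda>f. Comp C M N P g f)"
    and Comp_assoc: "\<lbrakk>M \<in> Obj C; N \<in> Obj C; P \<in> Obj C; Q \<in> Obj C;
        f \<in> carrier (Hom C M N); g \<in> carrier (Hom C N P); h \<in> carrier (Hom C P Q)\<rbrakk>
      \<Longrightarrow> Comp C M P Q h (Comp C M N P g f) = Comp C M N Q (Comp C N P Q h g) f"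
    and Idt_left: "\<lbrakk>M \<in> Obj C; N \<in> Obj C; f \<in> carrier (Hom C M N)\<rbrakk>
      \<Longrightarrow> Comp C M N N (Idt C N) f = f"
    and Idt_right: "\<lbrakk>M \<in> Obj C; N \<in> Obj C; f \<in> carrier (Hom C M N)\<rbrakk>
      \<Longrightarrow> Comp C M M N f (Idt C M) = f"

definition op_cat :: "('o, 'm, 'k, 'z) category_data_scheme \<Rightarrow> ('o, 'm, 'k) category_data" where
  "op_cat C = \<lparr>Obj = Obj C, Hom = (\<lambda>M N. Hom C N M),
     Comp = (\<lambda>M N P g f. Comp C P N M f g), Idt = Idt C\<rparr>"

definition zero_Hom :: "('o, 'm, 'k, 'z) category_data_scheme \<Rightarrow> 'o \<Rightarrow> 'o \<Rightarrow> bool" where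
  "zero_Hom C M N \<longleftrightarrow> carrier (Hom C M N) = {\<zero>\<^bsub>Hom C M N\<^esub>}"

definition inverse_morphisms ::
    "('o, 'm, 'k, 'z) category_data_scheme \<Rightarrow> 'o \<Rightarrow> 'o \<Rightarrow> 'm \<Rightarrow> 'm \<Rightarrow> bool" where
  "inverse_morphisms C M N f g \<longleftrightarrow>
     f \<in> carrier (Hom C M N) \<and> g \<in> carrier (Hom C N M) \<and>
     Comp C M N M g f = Idt C M \<and> Comp C N M N f g = Idt C N"

definition isomorphic :: "('o, 'm, 'k, 'z) category_data_scheme \<Rightarrow> 'o \<Rightarrow> 'o \<Rightarrow> bool" where
  "isomorphic C M N \<longleftrightarrow> M \<in> Obj C \<and> N \<in> Obj C \<and> (\<exists>f g. inverse_morphisms C M N f g)"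

definition zero_object :: "('o, 'm, 'k, 'z) category_data_scheme \<Rightarrow> 'o \<Rightarrow> bool" where
  "zero_object C Z \<longleftrightarrow> Z \<in> Obj C \<and> (\<forall>M \<in> Obj C. zero_Hom C Z M \<and> zero_Hom C M Z)"

text \<open>Biproduct of a finite list of objects, by the usual equations for inclusions and projections.\<close>

definition is_direct_sum :: "('o, 'm, 'k, 'z) category_data_scheme \<Rightarrow> 'o list \<Rightarrow> 'o \<Rightarrow> bool" where
  "is_direct_sum C Xs S \<longleftrightarrow> set Xs \<subseteq> Obj C \<and> S \<in> Obj C \<and>
     (\<exists>i p.
       (\<forall>j < length Xs. i j \<in> carrier (Hom C (Xs ! j) S) \<and> p j \<in> carrier (Hom C S (Xs ! j))) \<and>
       (\<forall>j < length Xs. \<forall>l < length Xs. Comp C (Xs ! l) S (Xs ! j) (p j) (i l) =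
          (if j = l then Idt C (Xs ! j) else \<zero>\<^bsub>Hom C (Xs ! l) (Xs ! j)\<^esub>)) \<and>
       (\<Oplus>\<^bsub>Hom C S S\<^esub> j \<in> {..<length Xs}. Comp C S (Xs ! j) S (i j) (p j)) = Idt C S)"

definition additive_category :: "('o, 'm, 'k, 'z) category_data_scheme \<Rightarrow> bool" where
  "additive_category C \<longleftrightarrow> (\<exists>Z. zero_object C Z) \<and>
     (\<forall>Xs. set Xs \<subseteq> Obj C \<longrightarrow> (\<exists>S. is_direct_sum C Xs S))"

definition indecomposable :: "('o, 'm, 'k, 'z) category_data_scheme \<Rightarrow> 'o \<Rightarrow> bool" where
  "indecomposable C M \<longleftrightarrow> M \<in> Obj C \<and> \<not> zero_object C M \<and>
     (\<forall>A B. is_direct_sum C [A, B] M \<longrightarrow> zero_object C A \<or> zero_object C B)"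

definition End_ring :: "('o, 'm, 'k, 'z) category_data_scheme \<Rightarrow> 'o \<Rightarrow> 'm ring" where
  "End_ring C M = \<lparr>carrier = carrier (Hom C M M), monoid.mult = Comp C M M M, monoid.one = Idt C M,
     ring.zero = \<zero>\<^bsub>Hom C M M\<^esub>, add = add (Hom C M M)\<rparr>"

definition nonunits :: "('a, 'z) ring_scheme \<Rightarrow> 'a set" where
  "nonunits R = carrier R - Units R"

text \<open>The rings here are not assumed commutative, so the ideal is two-sided. It is proper, as it
  contains \<open>\<zero>\<close>, which is therefore no unit.\<close>

definition is_local_ring :: "('a, 'z) ring_scheme \<Rightarrow> bool" where
  "is_local_ring R \<longleftrightarrow> ring R \<and> ideal (nonunits R) R"

definition krull_schmidt :: "('o, 'm, 'k, 'z) category_data_scheme \<Rightarrow> bool" where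
  "krull_schmidt C \<longleftrightarrow> (\<forall>M \<in> Obj C. \<exists>Xs.
     is_direct_sum C Xs M \<and> (\<forall>X \<in> set Xs. is_local_ring (End_ring C X)))"

definition End_scalar :: "('o, 'm, 'k, 'z) category_data_scheme \<Rightarrow> 'o \<Rightarrow> 'k \<Rightarrow> 'm" where
  "End_scalar C M x = x \<odot>\<^bsub>Hom C M M\<^esub> Idt C M"


section \<open>Functors\<close>

text \<open>A contravariant functor from \<open>C\<close> to \<open>D\<close> is a functor from \<open>op_cat C\<close> to \<open>D\<close>.\<close>

record ('o, 'm, 'p, 'n) functor_data =
  FObj :: "'o \<Rightarrow> 'p"
  FMap :: "'o \<Rightarrow> 'o \<Rightarrow> 'm \<Rightarrow> 'n"

locale linear_functor =
  dom: linear_category K C + cod: linear_category K D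
  for K :: "'k ring" and C :: "('o, 'm, 'k, 'y) category_data_scheme"
    and D :: "('p, 'n, 'k, 'z) category_data_scheme" +
  fixes F :: "('o, 'm, 'p, 'n) functor_data"
  assumes FObj_closed: "M \<in> Obj C \<Longrightarrow> FObj F M \<in> Obj D"
    and FMap_linear: "\<lbrakk>M \<in> Obj C; N \<in> Obj C\<rbrakk>
      \<Longrightarrow> linear_map K (Hom C M N) (Hom D (FObj F M) (FObj F N)) (FMap F M N)"
    and FMap_Idt: "M \<in> Obj C \<Longrightarrow> FMap F M M (Idt C M) = Idt D (FObj F M)"
    and FMap_Comp: "\<lbrakk>M \<in> Obj C; N \<in> Obj C; P \<in> Obj C;
        f \<in> carrier (Hom C M N); g \<in> carrier (Hom C N P)\<rbrakk>
      \<Longrightarrow> FMap F M P (Comp C M N P g f) =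
          Comp D (FObj F M) (FObj F N) (FObj F P) (FMap F N P g) (FMap F M N f)"

definition full_functor :: "('o, 'm, 'k, 'y) category_data_scheme \<Rightarrow>
    ('p, 'n, 'k, 'z) category_data_scheme \<Rightarrow> ('o, 'm, 'p, 'n) functor_data \<Rightarrow> bool" where
  "full_functor C D F \<longleftrightarrow> (\<forall>M \<in> Obj C. \<forall>N \<in> Obj C.
     FMap F M N ` carrier (Hom C M N) = carrier (Hom D (FObj F M) (FObj F N)))"

definition faithful_functor :: "('o, 'm, 'k, 'y) category_data_scheme \<Rightarrow>
    ('o, 'm, 'p, 'n) functor_data \<Rightarrow> bool" where
  "faithful_functor C F \<longleftrightarrow> (\<forall>M \<in> Obj C. \<forall>N \<in> Obj C. inj_on (FMap F M N) (carrier (Hom C M N)))"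

definition essentially_surjective :: "('o, 'm, 'k, 'y) category_data_scheme \<Rightarrow>
    ('p, 'n, 'k, 'z) category_data_scheme \<Rightarrow> ('o, 'm, 'p, 'n) functor_data \<Rightarrow> bool" where
  "essentially_surjective C D F \<longleftrightarrow> (\<forall>N \<in> Obj D. \<exists>M \<in> Obj C. isomorphic D (FObj F M) N)"

definition id_functor :: "('o, 'm, 'o, 'm) functor_data" where
  "id_functor = \<lparr>FObj = (\<lambda>M. M), FMap = (\<lambda>M N f. f)\<rparr>"

definition comp_functor :: "('p, 'n, 'q, 'l) functor_data \<Rightarrow> ('o, 'm, 'p, 'n) functor_data \<Rightarrow>
    ('o, 'm, 'q, 'l) functor_data" where
  "comp_functor G F = \<lparr>FObj = (\<lambda>M. FObj G (FObj F M)),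
     FMap = (\<lambda>M N f. FMap G (FObj F M) (FObj F N) (FMap F M N f))\<rparr>"

text \<open>The functor \<open>op_cat C \<rightarrow> op_cat D\<close> given by a functor \<open>C \<rightarrow> D\<close>.\<close>

definition op_functor :: "('o, 'm, 'p, 'n) functor_data \<Rightarrow> ('o, 'm, 'p, 'n) functor_data" where
  "op_functor F = \<lparr>FObj = FObj F, FMap = (\<lambda>M N. FMap F N M)\<rparr>"

definition naturally_isomorphic :: "('o, 'm, 'k, 'y) category_data_scheme \<Rightarrow>
    ('p, 'n, 'k, 'z) category_data_scheme \<Rightarrow> ('o, 'm, 'p, 'n) functor_data \<Rightarrow>
    ('o, 'm, 'p, 'n) functor_data \<Rightarrow> bool" where
  "naturally_isomorphic C D F G \<longleftrightarrow> (\<exists>\<eta>.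
     (\<forall>M \<in> Obj C. \<exists>g. inverse_morphisms D (FObj F M) (FObj G M) (\<eta> M) g) \<and>
     (\<forall>M \<in> Obj C. \<forall>N \<in> Obj C. \<forall>f \<in> carrier (Hom C M N).
        Comp D (FObj F M) (FObj F N) (FObj G N) (\<eta> N) (FMap F M N f) =
        Comp D (FObj F M) (FObj G M) (FObj G N) (FMap G M N f) (\<eta> M)))"


section \<open>Humorous categories\<close>

text \<open>\<open>Shift\<close> is the functor \<open>(1)\<close>, \<open>Unshift\<close> its inverse \<open>(-1)\<close>, and \<open>Dual\<close> the duality.\<close>

record ('o, 'm, 'k) graded_data = "('o, 'm, 'k) category_data" +
  Shift :: "('o, 'm, 'o, 'm) functor_data"
  Unshift :: "('o, 'm, 'o, 'm) functor_data"
  Dual :: "('o, 'm, 'o, 'm) functor_data"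

definition shift :: "('o, 'm, 'k, 'z) graded_data_scheme \<Rightarrow> int \<Rightarrow> 'o \<Rightarrow> 'o" where
  "shift C n M = (if 0 \<le> n then (FObj (Shift C) ^^ nat n) M else (FObj (Unshift C) ^^ nat (- n)) M)"

abbreviation dual :: "('o, 'm, 'k, 'z) graded_data_scheme \<Rightarrow> 'o \<Rightarrow> 'o" where
  "dual C \<equiv> FObj (Dual C)"

text \<open>Two indecomposable objects are related iff their isomorphism classes lie in the same orbit of
  the shift. An orbit of isomorphism classes is encoded as the set of all objects in these classes.\<close>

definition orbit_rel :: "('o, 'm, 'k, 'z) graded_data_scheme \<Rightarrow> ('o \<times> 'o) set" where
  "orbit_rel C = {(M, N). indecomposable C M \<and> indecomposable C N \<and> (\<exists>n. isomorphic C (shift C n M) N)}"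

definition orbits :: "('o, 'm, 'k, 'z) graded_data_scheme \<Rightarrow> 'o set set" where
  "orbits C = {M. indecomposable C M} // orbit_rel C"

definition orthodox_object :: "('o, 'm, 'k, 'z) graded_data_scheme \<Rightarrow> 'o set \<Rightarrow> 'o" where
  "orthodox_object C c = (SOME P. P \<in> c \<and> isomorphic C (dual C P) P)"

text \<open>The shift is invertible up to natural isomorphism, i.e. an autoequivalence, and a duality is a
  contravariant autoequivalence. That the residue field of \<open>End P\<close> is \<open>K\<close> means
  that the structure map \<open>x \<mapsto> x id\<close>, composed with the quotient map, is an isomorphism.\<close>

locale humorous_category = linear_category K C
  for K :: "'k ring" and C :: "('o, 'm, 'k, 'z) graded_data_scheme" +
  assumes additive: "additive_category C"
    and krull_schmidt: "krull_schmidt C"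
    and Shift_functor: "linear_functor K C C (Shift C)"
    and Unshift_functor: "linear_functor K C C (Unshift C)"
    and Shift_Unshift: "naturally_isomorphic C C (comp_functor (Shift C) (Unshift C)) id_functor"
    and Unshift_Shift: "naturally_isomorphic C C (comp_functor (Unshift C) (Shift C)) id_functor"
    and shift_free: "\<lbrakk>indecomposable C M; isomorphic C (shift C n M) M\<rbrakk> \<Longrightarrow> n = 0"
    and finite_orbits: "finite (orbits C)"
    and Dual_functor: "linear_functor K (op_cat C) C (Dual C)"
    and Dual_full: "full_functor (op_cat C) C (Dual C)"
    and Dual_faithful: "faithful_functor (op_cat C) (Dual C)"
    and Dual_essentially_surjective: "essentially_surjective (op_cat C) C (Dual C)"
    and Dual_Shift: "M \<in> Obj C \<Longrightarrow> isomorphic C (dual C (shift C 1 M)) (shift C (- 1) (dual C M))"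
    and fixed_point_exists: "c \<in> orbits C \<Longrightarrow> \<exists>P \<in> c. isomorphic C (dual C P) P"
    and fixed_point_unique: "\<lbrakk>c \<in> orbits C; P \<in> c; Q \<in> c;
        isomorphic C (dual C P) P; isomorphic C (dual C Q) Q\<rbrakk> \<Longrightarrow> isomorphic C P Q"
    and Hom_bounded: "\<lbrakk>M \<in> Obj C; N \<in> Obj C\<rbrakk> \<Longrightarrow> \<exists>i0. \<forall>i \<le> i0. zero_Hom C M (shift C i N)"
    and Hom_fin_dim: "\<lbrakk>M \<in> Obj C; N \<in> Obj C\<rbrakk> \<Longrightarrow> vectorspace.fin_dim K (Hom C M N)"
    and End_local: "c \<in> orbits C \<Longrightarrow> is_local_ring (End_ring C (orthodox_object C c))"
    and residue_field: "\<lbrakk>c \<in> orbits C; P = orthodox_object C c; R = End_ring C P\<rbrakk> \<Longrightarrow>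
        (\<lambda>x. nonunits R +>\<^bsub>R\<^esub> End_scalar C P x) \<in> ring_iso K (R Quot nonunits R)"

text \<open>An isomorphism of \<open>K\<close>-algebras from \<open>K\<close> to \<open>End M\<close> is necessarily the structure map.\<close>

definition mixed :: "'k ring \<Rightarrow> ('o, 'm, 'k, 'z) graded_data_scheme \<Rightarrow> bool" where
  "mixed K C \<longleftrightarrow> (\<exists>wt :: 'o \<Rightarrow> int.
     (\<forall>M. indecomposable C M \<longrightarrow>
        wt (shift C 1 M) = wt M + 1 \<and> wt (dual C M) = - wt M \<and>
        End_scalar C M \<in> ring_iso K (End_ring C M)) \<and>
     (\<forall>M N. indecomposable C M \<and> indecomposable C N \<and>
        (wt N < wt M \<or> \<not> isomorphic C M N \<and> wt N = wt M) \<longrightarrow> zero_Hom C M N))"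


section \<open>The split Grothendieck group\<close>

definition K0_relations :: "('o, 'm, 'k, 'z) category_data_scheme \<Rightarrow> ('o \<Rightarrow>\<^sub>0 int) set" where
  "K0_relations C = generate (free_Abelian_group (Obj C))
     {frag_of S - frag_of A - frag_of B | S A B. is_direct_sum C [A, B] S}"

definition K0_coset :: "('o, 'm, 'k, 'z) category_data_scheme \<Rightarrow> ('o \<Rightarrow>\<^sub>0 int) \<Rightarrow> ('o \<Rightarrow>\<^sub>0 int) set" where
  "K0_coset C x = K0_relations C #>\<^bsub>free_Abelian_group (Obj C)\<^esub> x"

definition K0_class :: "('o, 'm, 'k, 'z) category_data_scheme \<Rightarrow> 'o \<Rightarrow> ('o \<Rightarrow>\<^sub>0 int) set" where
  "K0_class C M = K0_coset C (frag_of M)"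

text \<open>The Laurent polynomial \<open>\<Sum> p\<^sub>n q\<^sup>n\<close> is the finitely supported function \<open>p :: int \<Rightarrow>\<^sub>0 int\<close>, with
  \<open>q\<^sup>n [M] = [M(n)]\<close>. The multiplicative fields of the module record are unused.\<close>

definition K0 :: "('o, 'm, 'k, 'z) graded_data_scheme \<Rightarrow>
    (int \<Rightarrow>\<^sub>0 int, ('o \<Rightarrow>\<^sub>0 int) set) module" where
  "K0 C = \<lparr>carrier = carrier (free_Abelian_group (Obj C) Mod K0_relations C),
     monoid.mult = undefined, monoid.one = undefined,
     ring.zero = \<one>\<^bsub>free_Abelian_group (Obj C) Mod K0_relations C\<^esub>,
     ring.add = monoid.mult (free_Abelian_group (Obj C) Mod K0_relations C),
     module.smult = (\<lambda>p X. the_elem ((\<lambda>x. K0_coset C (\<Sum>n \<in> Poly_Mapping.keys p.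
       frag_cmul (Poly_Mapping.lookup p n) (frag_extend (\<lambda>M. frag_of (shift C n M)) x))) ` X))\<rparr>"

text \<open>The map induced on split Grothendieck groups by an additive functor, \<open>[M] \<mapsto> [F M]\<close>.\<close>

definition K0_map :: "('p, 'n, 'k, 'z) category_data_scheme \<Rightarrow> ('o, 'm, 'p, 'n) functor_data \<Rightarrow>
    ('o \<Rightarrow>\<^sub>0 int) set \<Rightarrow> ('p \<Rightarrow>\<^sub>0 int) set" where
  "K0_map D F X = the_elem ((\<lambda>x. K0_coset D (frag_extend (\<lambda>M. frag_of (FObj F M)) x)) ` X)"

definition orthodox_basis :: "('o, 'm, 'k, 'z) graded_data_scheme \<Rightarrow> ('o \<Rightarrow>\<^sub>0 int) set set" where
  "orthodox_basis C = (\<lambda>c. K0_class C (orthodox_object C c)) ` orbits C"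

end

theory Submission
  imports Defs
begin

text \<open>
  Call a nonzero object a brick if all its endomorphisms are scalar. In a mixed category the
  indecomposable objects are exactly the bricks. A full functor \<open>F\<close> sends a brick to a brick or to a
  zero object. It also reflects isomorphisms between bricks with nonzero images: if \<open>F g \<circ> F f\<close> is
  the identity, then \<open>g \<circ> f\<close> is a nonzero scalar. By essential surjectivity and the Krull--Schmidt
  property, every indecomposable of the target is the image of a brick, unique up to isomorphism, so
  weights and self-duality can be transported along \<open>F\<close>.

  That distinct indecomposables of a mixed category have distinct classes in the split Grothendieck
  group needs no Krull--Schmidt uniqueness: the class of \<open>N\<close> determines \<open>dim Hom(X, N)\<close> for all \<open>X\<close>,
  and by the weight conditions two indecomposables with nonzero morphisms in both directions are
  isomorphic.
\<close>

section \<open>Linear categories\<close>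

text \<open>Bricks are used because, unlike indecomposability, the condition concerns a single
  endomorphism space: shift and duality preserve it, a full functor transports it, and no weight
  occurs in it. The indecomposables of the target can therefore be identified before the target is
  known to be mixed. The order matters: uniqueness of the preimage of an orthodox basis vector
  compares classes in the target, and the dimension argument that separates these classes relies on
  weights there.

  Two points are less automatic than they look. And the orthodox basis is defined by choosing one
  self-dual object per orbit; it is rewritten as the set of classes of all self-dual
  indecomposables, after which orbits matter only for finiteness.\<close>

lemma (in vectorspace) smult_cancel:
  assumes "x \<in> carrier K" "y \<in> carrier K" "v \<in> carrier V" "v \<noteq> \<zero>\<^bsub>V\<^esub>"
    and eq: "x \<odot>\<^bsub>V\<^esub> v = y \<odot>\<^bsub>V\<^esub> v"
  shows "x = y"
proof (rule ccontr)
  assume "x \<noteq> y"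
  let ?d = "x \<ominus>\<^bsub>K\<^esub> y"
  have d: "?d \<in> carrier K" "?d \<noteq> \<zero>\<^bsub>K\<^esub>"
    using assms \<open>x \<noteq> y\<close> R.minus_other_side by auto
  have "?d \<odot>\<^bsub>V\<^esub> v = \<zero>\<^bsub>V\<^esub>"
    using assms by (simp add: a_minus_def smult_l_distr smult_l_minus M.r_neg)
  moreover have "v = (inv\<^bsub>K\<^esub> ?d \<otimes>\<^bsub>K\<^esub> ?d) \<odot>\<^bsub>V\<^esub> v"
    using d field_Units assms(3) by (simp add: R.Units_l_inv)
  moreover have "\<dots> = inv\<^bsub>K\<^esub> ?d \<odot>\<^bsub>V\<^esub> (?d \<odot>\<^bsub>V\<^esub> v)"
    using d field_Units assms(3) by (intro smult_assoc1) auto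
  ultimately have "v = \<zero>\<^bsub>V\<^esub>"
    using d field_Units by simp
  then show False using assms(4) by simp
qed

lemma (in linear_map) T_finsum:
  assumes "finite A" and "g \<in> A \<rightarrow> carrier V"
  shows "T (\<Oplus>\<^bsub>V\<^esub>a\<in>A. g a) = (\<Oplus>\<^bsub>W\<^esub>a\<in>A. T (g a))"
  using assms
proof (induction A rule: finite_induct)
  case (insert a A)
  then have "g a \<in> carrier V" "g \<in> A \<rightarrow> carrier V" by auto
  with insert show ?case
    by (subst W.module.M.finsum_insert) auto
qed auto

context linear_category
begin

section \<open>Morphism spaces and bilinearity of composition\<close>

lemma abelian_group_Hom: "M \<in> Obj C \<Longrightarrow> N \<in> Obj C \<Longrightarrow> abelian_group (Hom C M N)"
  using vectorspace_Hom[of M N] by (simp add: vectorspace_def module_def)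

lemma Hom_zero_closed: "M \<in> Obj C \<Longrightarrow> N \<in> Obj C \<Longrightarrow> \<zero>\<^bsub>Hom C M N\<^esub> \<in> carrier (Hom C M N)"
  using abelian_group_Hom[of M N] by (simp add: abelian_group_def abelian_monoid.zero_closed)

lemma Hom_add_closed: "M \<in> Obj C \<Longrightarrow> N \<in> Obj C \<Longrightarrow> f \<in> carrier (Hom C M N) \<Longrightarrow>
    g \<in> carrier (Hom C M N) \<Longrightarrow> f \<oplus>\<^bsub>Hom C M N\<^esub> g \<in> carrier (Hom C M N)"
  using abelian_group_Hom[of M N] by (simp add: abelian_group_def abelian_monoid.a_closed)

lemma Hom_finsum_closed: "M \<in> Obj C \<Longrightarrow> N \<in> Obj C \<Longrightarrow> g \<in> A \<rightarrow> carrier (Hom C M N) \<Longrightarrow>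
    finsum (Hom C M N) g A \<in> carrier (Hom C M N)"
  using abelian_group_Hom[of M N] by (simp add: abelian_group_def abelian_monoid.finsum_closed)

lemma Hom_l_zero: "M \<in> Obj C \<Longrightarrow> N \<in> Obj C \<Longrightarrow> f \<in> carrier (Hom C M N) \<Longrightarrow>
    \<zero>\<^bsub>Hom C M N\<^esub> \<oplus>\<^bsub>Hom C M N\<^esub> f = f"
  using abelian_group_Hom[of M N] by (simp add: abelian_group_def abelian_monoid.l_zero)

lemma Hom_r_zero: "M \<in> Obj C \<Longrightarrow> N \<in> Obj C \<Longrightarrow> f \<in> carrier (Hom C M N) \<Longrightarrow>
    f \<oplus>\<^bsub>Hom C M N\<^esub> \<zero>\<^bsub>Hom C M N\<^esub> = f"
  using abelian_group_Hom[of M N] by (simp add: abelian_group_def abelian_monoid.r_zero)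

lemma Hom_smult_closed: "M \<in> Obj C \<Longrightarrow> N \<in> Obj C \<Longrightarrow> x \<in> carrier K \<Longrightarrow>
    f \<in> carrier (Hom C M N) \<Longrightarrow> x \<odot>\<^bsub>Hom C M N\<^esub> f \<in> carrier (Hom C M N)"
  using vectorspace_Hom[of M N] by (auto simp: vectorspace_def intro: module.smult_closed)

lemma Comp_closed:
  assumes "M \<in> Obj C" "N \<in> Obj C" "P \<in> Obj C"
    and "f \<in> carrier (Hom C M N)" "g \<in> carrier (Hom C N P)"
  shows "Comp C M N P g f \<in> carrier (Hom C M P)"
proof -
  interpret linear_map K "Hom C M N" "Hom C M P" "\<lambda>f. Comp C M N P g f"
    using assms by (intro Comp_linear_right)
  show ?thesis using assms T_im by blast
qed

lemma Comp_zero_right: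
  assumes "M \<in> Obj C" "N \<in> Obj C" "P \<in> Obj C" "g \<in> carrier (Hom C N P)"
  shows "Comp C M N P g \<zero>\<^bsub>Hom C M N\<^esub> = \<zero>\<^bsub>Hom C M P\<^esub>"
proof -
  interpret linear_map K "Hom C M N" "Hom C M P" "\<lambda>f. Comp C M N P g f"
    using assms by (intro Comp_linear_right)
  show ?thesis by (rule T0_is_0)
qed

lemma Comp_zero_left:
  assumes "M \<in> Obj C" "N \<in> Obj C" "P \<in> Obj C" "f \<in> carrier (Hom C M N)"
  shows "Comp C M N P \<zero>\<^bsub>Hom C N P\<^esub> f = \<zero>\<^bsub>Hom C M P\<^esub>"
proof -
  interpret linear_map K "Hom C N P" "Hom C M P" "\<lambda>g. Comp C M N P g f"
    using assms by (intro Comp_linear_left)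
  show ?thesis by (rule T0_is_0)
qed

lemma Comp_smult_right:
  assumes "M \<in> Obj C" "N \<in> Obj C" "P \<in> Obj C"
    and "f \<in> carrier (Hom C M N)" "g \<in> carrier (Hom C N P)" "x \<in> carrier K"
  shows "Comp C M N P g (x \<odot>\<^bsub>Hom C M N\<^esub> f) = x \<odot>\<^bsub>Hom C M P\<^esub> Comp C M N P g f"
proof -
  interpret linear_map K "Hom C M N" "Hom C M P" "\<lambda>f. Comp C M N P g f"
    using assms by (intro Comp_linear_right)
  show ?thesis using assms T_smult by blast
qed

lemma Comp_smult_left:
  assumes "M \<in> Obj C" "N \<in> Obj C" "P \<in> Obj C"
    and "f \<in> carrier (Hom C M N)" "g \<in> carrier (Hom C N P)" "x \<in> carrier K"
  shows "Comp C M N P (x \<odot>\<^bsub>Hom C N P\<^esub> g) f = x \<odot>\<^bsub>Hom C M P\<^esub> Comp C M N P g f"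
proof -
  interpret linear_map K "Hom C N P" "Hom C M P" "\<lambda>g. Comp C M N P g f"
    using assms by (intro Comp_linear_left)
  show ?thesis using assms T_smult by blast
qed

lemma Comp_add_left:
  assumes "M \<in> Obj C" "N \<in> Obj C" "P \<in> Obj C"
    and "f \<in> carrier (Hom C M N)" "g \<in> carrier (Hom C N P)" "g' \<in> carrier (Hom C N P)"
  shows "Comp C M N P (g \<oplus>\<^bsub>Hom C N P\<^esub> g') f = Comp C M N P g f \<oplus>\<^bsub>Hom C M P\<^esub> Comp C M N P g' f"
proof -
  interpret linear_map K "Hom C N P" "Hom C M P" "\<lambda>g. Comp C M N P g f"
    using assms by (intro Comp_linear_left)
  show ?thesis using assms T_add by blast
qed

lemma Comp_finsum_right:
  assumes "M \<in> Obj C" "N \<in> Obj C" "P \<in> Obj C" "g \<in> carrier (Hom C N P)"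
    and "finite A" "h \<in> A \<rightarrow> carrier (Hom C M N)"
  shows "Comp C M N P g (\<Oplus>\<^bsub>Hom C M N\<^esub>a\<in>A. h a) = (\<Oplus>\<^bsub>Hom C M P\<^esub>a\<in>A. Comp C M N P g (h a))"
proof -
  interpret linear_map K "Hom C M N" "Hom C M P" "\<lambda>f. Comp C M N P g f"
    using assms by (intro Comp_linear_right)
  show ?thesis using assms by (intro T_finsum)
qed

lemma Comp_finsum_left:
  assumes "M \<in> Obj C" "N \<in> Obj C" "P \<in> Obj C" "f \<in> carrier (Hom C M N)"
    and "finite A" "h \<in> A \<rightarrow> carrier (Hom C N P)"
  shows "Comp C M N P (\<Oplus>\<^bsub>Hom C N P\<^esub>a\<in>A. h a) f = (\<Oplus>\<^bsub>Hom C M P\<^esub>a\<in>A. Comp C M N P (h a) f)"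
proof -
  interpret linear_map K "Hom C N P" "Hom C M P" "\<lambda>g. Comp C M N P g f"
    using assms by (intro Comp_linear_left)
  show ?thesis using assms by (intro T_finsum)
qed

lemmas Hom_closed = Idt_closed Hom_zero_closed Hom_add_closed Hom_smult_closed Comp_closed

section \<open>Isomorphism and zero objects\<close>

lemma isomorphic_refl: "M \<in> Obj C \<Longrightarrow> isomorphic C M M"
  unfolding isomorphic_def inverse_morphisms_def
  using Idt_closed Idt_left by blast

lemma isomorphic_sym: "isomorphic C M N \<Longrightarrow> isomorphic C N M"
  unfolding isomorphic_def inverse_morphisms_def by blast

lemma isomorphic_trans:
  assumes "isomorphic C M N" and "isomorphic C N P"
  shows "isomorphic C M P"
proof -
  from assms have O: "M \<in> Obj C" "N \<in> Obj C" "P \<in> Obj C" by (auto simp: isomorphic_def)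
  obtain f g where f: "f \<in> carrier (Hom C M N)" and g: "g \<in> carrier (Hom C N M)"
    and gf: "Comp C M N M g f = Idt C M" and fg: "Comp C N M N f g = Idt C N"
    using assms(1) by (auto simp: isomorphic_def inverse_morphisms_def)
  obtain h k where h: "h \<in> carrier (Hom C N P)" and k: "k \<in> carrier (Hom C P N)"
    and kh: "Comp C N P N k h = Idt C N" and hk: "Comp C P N P h k = Idt C P"
    using assms(2) by (auto simp: isomorphic_def inverse_morphisms_def)
  have "Comp C M P M (Comp C P N M g k) (Comp C M N P h f) = Comp C M N M g (Comp C M N N (Comp C N P N k h) f)"
    using O f g h k by (simp add: Comp_assoc[symmetric] Comp_closed)
  moreover have "Comp C P M P (Comp C M N P h f) (Comp C P N M g k) = Comp C P N P h (Comp C P N N (Comp C N M N f g) k)"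
    using O f g h k by (simp add: Comp_assoc[symmetric] Comp_closed)
  ultimately have "inverse_morphisms C M P (Comp C M N P h f) (Comp C P N M g k)"
    unfolding inverse_morphisms_def using O f g h k gf fg kh hk
    by (simp add: Comp_closed Idt_left)
  then show ?thesis using O by (auto simp: isomorphic_def)
qed

text \<open>Every \<open>u\<close> in the new space factors as \<open>h (k u f) g\<close>, and the
  middle factor \<open>k u f\<close> lies in the space that vanishes.\<close>

lemma zero_Hom_isomorphic:
  assumes "isomorphic C M M'" and "isomorphic C N N'" and Z: "zero_Hom C M N"
  shows "zero_Hom C M' N'"
proof -
  from assms have O: "M \<in> Obj C" "M' \<in> Obj C" "N \<in> Obj C" "N' \<in> Obj C" by (auto simp: isomorphic_def)
  obtain f g where f: "f \<in> carrier (Hom C M M')" and g: "g \<in> carrier (Hom C M' M)"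
    and fg: "Comp C M' M M' f g = Idt C M'"
    using assms(1) by (auto simp: isomorphic_def inverse_morphisms_def)
  obtain h k where h: "h \<in> carrier (Hom C N N')" and k: "k \<in> carrier (Hom C N' N)"
    and hk: "Comp C N' N N' h k = Idt C N'"
    using assms(2) by (auto simp: isomorphic_def inverse_morphisms_def)
  have "u = \<zero>\<^bsub>Hom C M' N'\<^esub>" if u: "u \<in> carrier (Hom C M' N')" for u
  proof -
    let ?v = "Comp C M N' N k (Comp C M M' N' u f)"
    have "u = Comp C M' N' N' (Idt C N') (Comp C M' M' N' u (Idt C M'))"
      using O u by (simp add: Idt_left Idt_right)
    also have "\<dots> = Comp C M' N N' h (Comp C M' M N ?v g)"
    proof -
      have "Comp C M' M' N' u (Comp C M' M M' f g) = Comp C M' M N' (Comp C M M' N' u f) g"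
        using O f g u by (intro Comp_assoc)
      moreover have "Comp C M' N' N' (Comp C N' N N' h k) (Comp C M' M N' (Comp C M M' N' u f) g)
          = Comp C M' N N' h (Comp C M' N' N k (Comp C M' M N' (Comp C M M' N' u f) g))"
        using O f g h k u by (intro Comp_assoc[symmetric] Comp_closed)
      moreover have "Comp C M' N' N k (Comp C M' M N' (Comp C M M' N' u f) g) = Comp C M' M N ?v g"
        using O f g k u by (intro Comp_assoc Comp_closed)
      ultimately show ?thesis using fg hk by simp
    qed
    also have "?v \<in> carrier (Hom C M N)"
      using O f k u by (intro Comp_closed)
    then have "?v = \<zero>\<^bsub>Hom C M N\<^esub>"
      using Z by (simp add: zero_Hom_def)
    finally show ?thesis using O g h by (simp add: Comp_zero_left Comp_zero_right)
  qed
  then show ?thesis unfolding zero_Hom_def using O Hom_zero_closed by blast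
qed

text \<open>Reduces the vanishing of all morphism spaces to one equation, which linear functors
  preserve and faithful ones reflect.\<close>

lemma zero_object_iff:
  assumes "M \<in> Obj C"
  shows "zero_object C M \<longleftrightarrow> Idt C M = \<zero>\<^bsub>Hom C M M\<^esub>"
proof
  assume "zero_object C M"
  then show "Idt C M = \<zero>\<^bsub>Hom C M M\<^esub>"
    using assms Idt_closed[OF assms] by (auto simp: zero_object_def zero_Hom_def)
next
  assume 0: "Idt C M = \<zero>\<^bsub>Hom C M M\<^esub>"
  have "f = \<zero>\<^bsub>Hom C M N\<^esub>" if "N \<in> Obj C" "f \<in> carrier (Hom C M N)" for N f
    using that assms Idt_right[of M N f] Comp_zero_right[of M M N f] 0 by simp
  moreover have "f = \<zero>\<^bsub>Hom C N M\<^esub>" if "N \<in> Obj C" "f \<in> carrier (Hom C N M)" for N f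
    using that assms Idt_left[of N M f] Comp_zero_left[of N M M f] 0 by simp
  ultimately show "zero_object C M"
    unfolding zero_object_def zero_Hom_def using assms Hom_zero_closed by blast
qed

lemma zero_object_iff_zero_Hom: "M \<in> Obj C \<Longrightarrow> zero_object C M \<longleftrightarrow> zero_Hom C M M"
  using zero_object_iff[of M] Idt_closed[of M] unfolding zero_object_def zero_Hom_def by blast

lemma zero_object_isomorphic: "isomorphic C M N \<Longrightarrow> zero_object C M \<Longrightarrow> zero_object C N"
  using zero_Hom_isomorphic[of M N M N]
  by (auto simp: zero_object_iff_zero_Hom isomorphic_def[of C M N])

section \<open>Biproducts\<close>

lemma is_direct_sum_pairI:
  assumes "A \<in> Obj C" "B \<in> Obj C" "S \<in> Obj C"
    and "iA \<in> carrier (Hom C A S)" "iB \<in> carrier (Hom C B S)"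
    and "pA \<in> carrier (Hom C S A)" "pB \<in> carrier (Hom C S B)"
    and "Comp C A S A pA iA = Idt C A" "Comp C B S B pB iB = Idt C B"
    and "Comp C B S A pA iB = \<zero>\<^bsub>Hom C B A\<^esub>" "Comp C A S B pB iA = \<zero>\<^bsub>Hom C A B\<^esub>"
    and "Comp C S A S iA pA \<oplus>\<^bsub>Hom C S S\<^esub> Comp C S B S iB pB = Idt C S"
  shows "is_direct_sum C [A, B] S"
proof -
  interpret abelian_group "Hom C S S" using assms by (intro abelian_group_Hom)
  have "(\<Oplus>\<^bsub>Hom C S S\<^esub>j\<in>{..<length [A, B]}. Comp C S ([A, B] ! j) S
      (if j = 0 then iA else iB) (if j = 0 then pA else pB)) = Idt C S"
  proof -
    have "{..<length [A, B]} = {0, Suc 0}" by auto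
    then show ?thesis
      using assms by (simp add: Comp_closed)
  qed
  then show ?thesis
    unfolding is_direct_sum_def using assms
    by (intro conjI exI[of _ "\<lambda>j. if j = 0 then iA else iB"] exI[of _ "\<lambda>j. if j = 0 then pA else pB"])
      (auto simp: less_Suc_eq)
qed

lemma is_direct_sum_pairE:
  assumes "is_direct_sum C [A, B] S"
  obtains iA iB pA pB where "A \<in> Obj C" "B \<in> Obj C" "S \<in> Obj C"
    and "iA \<in> carrier (Hom C A S)" "iB \<in> carrier (Hom C B S)"
    and "pA \<in> carrier (Hom C S A)" "pB \<in> carrier (Hom C S B)"
    and "Comp C A S A pA iA = Idt C A" "Comp C B S B pB iB = Idt C B"
    and "Comp C B S A pA iB = \<zero>\<^bsub>Hom C B A\<^esub>" "Comp C A S B pB iA = \<zero>\<^bsub>Hom C A B\<^esub>"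
    and "Comp C S A S iA pA \<oplus>\<^bsub>Hom C S S\<^esub> Comp C S B S iB pB = Idt C S"
proof -
  have O: "A \<in> Obj C" "B \<in> Obj C" "S \<in> Obj C" using assms by (auto simp: is_direct_sum_def)
  obtain i p where
    c: "\<forall>j < length [A,B]. i j \<in> carrier (Hom C ([A,B] ! j) S) \<and> p j \<in> carrier (Hom C S ([A,B] ! j))"
    and o: "\<forall>j < length [A,B]. \<forall>l < length [A,B]. Comp C ([A,B] ! l) S ([A,B] ! j) (p j) (i l) =
      (if j = l then Idt C ([A,B] ! j) else \<zero>\<^bsub>Hom C ([A,B] ! l) ([A,B] ! j)\<^esub>)"
    and s: "(\<Oplus>\<^bsub>Hom C S S\<^esub> j \<in> {..<length [A,B]}. Comp C S ([A,B] ! j) S (i j) (p j)) = Idt C S"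
    using assms unfolding is_direct_sum_def by blast
  interpret abelian_group "Hom C S S" using O by (intro abelian_group_Hom)
  have c': "i 0 \<in> carrier (Hom C A S)" "i 1 \<in> carrier (Hom C B S)"
    "p 0 \<in> carrier (Hom C S A)" "p 1 \<in> carrier (Hom C S B)"
    using c[rule_format, of 0] c[rule_format, of 1] by auto
  moreover have "{..<length [A, B]} = {0, 1}" by auto
  then have "Comp C S A S (i 0) (p 0) \<oplus>\<^bsub>Hom C S S\<^esub> Comp C S B S (i 1) (p 1) = Idt C S"
    using s O c' by (simp add: Comp_closed)
  ultimately show thesis
    using O o[rule_format, of 0 0] o[rule_format, of 0 1] o[rule_format, of 1 0] o[rule_format, of 1 1]
    by (intro that[of "i 0" "i 1" "p 0" "p 1"]) auto
qed

text \<open>The relations of \<open>K0\<close> speak only of direct sums; this sum is what makes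
  them identify isomorphic objects.\<close>

lemma is_direct_sum_zero_right:
  assumes "isomorphic C A S" and "zero_object C Z"
  shows "is_direct_sum C [A, Z] S"
proof -
  have O: "A \<in> Obj C" "S \<in> Obj C" "Z \<in> Obj C" using assms by (auto simp: isomorphic_def zero_object_def)
  obtain f g where f: "f \<in> carrier (Hom C A S)" and g: "g \<in> carrier (Hom C S A)"
    and "Comp C A S A g f = Idt C A" "Comp C S A S f g = Idt C S"
    using assms by (auto simp: isomorphic_def inverse_morphisms_def)
  then show ?thesis
    using O assms(2) zero_object_iff[of Z]
    by (intro is_direct_sum_pairI[of A Z S f "\<zero>\<^bsub>Hom C Z S\<^esub>" g "\<zero>\<^bsub>Hom C S Z\<^esub>"])
      (auto simp: Hom_closed Comp_zero_left Comp_zero_right Hom_r_zero)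
qed

lemma direct_sum_zero_right_isomorphic:
  assumes "is_direct_sum C [A, B] S" and "zero_object C B"
  shows "isomorphic C A S"
  using assms(1)
proof (rule is_direct_sum_pairE)
  fix iA iB pA pB
  assume *: "A \<in> Obj C" "B \<in> Obj C" "S \<in> Obj C"
    "iA \<in> carrier (Hom C A S)" "iB \<in> carrier (Hom C B S)"
    "pA \<in> carrier (Hom C S A)" "pB \<in> carrier (Hom C S B)"
    "Comp C A S A pA iA = Idt C A"
    "Comp C S A S iA pA \<oplus>\<^bsub>Hom C S S\<^esub> Comp C S B S iB pB = Idt C S"
  then have "pB = \<zero>\<^bsub>Hom C S B\<^esub>"
    using assms(2) by (auto simp: zero_object_def zero_Hom_def)
  then show ?thesis
    using * unfolding isomorphic_def inverse_morphisms_def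
    by (auto simp: Comp_zero_right Hom_r_zero Comp_closed)
qed

lemma direct_sum_zero_left_isomorphic:
  assumes "is_direct_sum C [A, B] S" and "zero_object C A"
  shows "isomorphic C B S"
  using assms(1)
proof (rule is_direct_sum_pairE)
  fix iA iB pA pB
  assume *: "A \<in> Obj C" "B \<in> Obj C" "S \<in> Obj C"
    "iA \<in> carrier (Hom C A S)" "iB \<in> carrier (Hom C B S)"
    "pA \<in> carrier (Hom C S A)" "pB \<in> carrier (Hom C S B)"
    "Comp C B S B pB iB = Idt C B"
    "Comp C S A S iA pA \<oplus>\<^bsub>Hom C S S\<^esub> Comp C S B S iB pB = Idt C S"
  then have "pA = \<zero>\<^bsub>Hom C S A\<^esub>"
    using assms(2) by (auto simp: zero_object_def zero_Hom_def)
  then show ?thesis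
    using * unfolding isomorphic_def inverse_morphisms_def
    by (auto simp: Comp_zero_right Hom_l_zero Comp_closed)
qed

text \<open>Inclusions are composed with \<open>f\<close> and projections with its inverse
  \<open>g\<close>; \<open>g f = id\<close> keeps the orthogonality relations,
  \<open>f g = id\<close> keeps the decomposition of the identity.\<close>

lemma is_direct_sum_isomorphic:
  assumes "is_direct_sum C Xs S" and "isomorphic C S S'"
  shows "is_direct_sum C Xs S'"
proof -
  have O: "set Xs \<subseteq> Obj C" "S \<in> Obj C" "S' \<in> Obj C"
    using assms by (auto simp: is_direct_sum_def isomorphic_def)
  then have X: "Xs ! j \<in> Obj C" if "j < length Xs" for j using that nth_mem by blast
  obtain f g where f: "f \<in> carrier (Hom C S S')" and g: "g \<in> carrier (Hom C S' S)"
    and gf: "Comp C S S' S g f = Idt C S" and fg: "Comp C S' S S' f g = Idt C S'"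
    using assms(2) by (auto simp: isomorphic_def inverse_morphisms_def)
  obtain i p where i: "\<And>j. j < length Xs \<Longrightarrow> i j \<in> carrier (Hom C (Xs ! j) S)"
    and p: "\<And>j. j < length Xs \<Longrightarrow> p j \<in> carrier (Hom C S (Xs ! j))"
    and o: "\<And>j l. j < length Xs \<Longrightarrow> l < length Xs \<Longrightarrow> Comp C (Xs ! l) S (Xs ! j) (p j) (i l) =
          (if j = l then Idt C (Xs ! j) else \<zero>\<^bsub>Hom C (Xs ! l) (Xs ! j)\<^esub>)"
    and s: "(\<Oplus>\<^bsub>Hom C S S\<^esub> j \<in> {..<length Xs}. Comp C S (Xs ! j) S (i j) (p j)) = Idt C S"
    using assms(1) unfolding is_direct_sum_def by blast
  let ?i = "\<lambda>j. Comp C (Xs ! j) S S' f (i j)"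
  let ?p = "\<lambda>j. Comp C S' S (Xs ! j) (p j) g"
  interpret abelian_group "Hom C S' S'" using O by (intro abelian_group_Hom)
  have "Comp C (Xs ! l) S' (Xs ! j) (?p j) (?i l) = Comp C (Xs ! l) S (Xs ! j) (p j) (i l)"
    if "j < length Xs" "l < length Xs" for j l
  proof -
    have "Comp C (Xs ! l) S' (Xs ! j) (?p j) (?i l)
        = Comp C (Xs ! l) S (Xs ! j) (p j) (Comp C (Xs ! l) S S (Comp C S S' S g f) (i l))"
      using O X that f g i p by (simp add: Comp_assoc[symmetric] Comp_closed)
    then show ?thesis using gf X O i that by (simp add: Idt_left)
  qed
  moreover have "(\<Oplus>\<^bsub>Hom C S' S'\<^esub> j \<in> {..<length Xs}. Comp C S' (Xs ! j) S' (?i j) (?p j)) = Idt C S'"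
  proof -
    have "(\<Oplus>\<^bsub>Hom C S' S'\<^esub> j \<in> {..<length Xs}. Comp C S' (Xs ! j) S' (?i j) (?p j))
       = (\<Oplus>\<^bsub>Hom C S' S'\<^esub> j \<in> {..<length Xs}. Comp C S' S S' (Comp C S S S' f (Comp C S (Xs ! j) S (i j) (p j))) g)"
      using O X f g i p by (intro finsum_cong') (auto simp: Comp_assoc[symmetric] Comp_closed)
    also have "\<dots> = Comp C S' S S' (\<Oplus>\<^bsub>Hom C S S'\<^esub> j \<in> {..<length Xs}.
        Comp C S S S' f (Comp C S (Xs ! j) S (i j) (p j))) g"
      using O X f g i p by (subst Comp_finsum_left) (auto simp: Comp_closed)
    also have "\<dots> = Comp C S' S S' (Comp C S S S' f (\<Oplus>\<^bsub>Hom C S S\<^esub> j \<in> {..<length Xs}.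
        Comp C S (Xs ! j) S (i j) (p j))) g"
      using O X f g i p by (subst Comp_finsum_right) (auto simp: Comp_closed)
    also have "\<dots> = Idt C S'"
      using s O f fg by (simp add: Idt_right)
    finally show ?thesis .
  qed
  ultimately show ?thesis
    unfolding is_direct_sum_def using O X f g i p o
    by (intro conjI exI[of _ ?i] exI[of _ ?p]) (auto simp: Comp_closed)
qed

text \<open>The inclusion of the complement is the sum of the remaining inclusions composed with the
  projections of \<open>B\<close>, and dually for its projection.\<close>

lemma is_direct_sum_Cons:
  assumes YS: "is_direct_sum C (Y # Ys) S" and B: "is_direct_sum C Ys B"
  shows "is_direct_sum C [Y, B] S"
proof -
  let ?n = "length Ys"
  have O: "Y \<in> Obj C" "set Ys \<subseteq> Obj C" "S \<in> Obj C" "B \<in> Obj C"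
    using assms by (auto simp: is_direct_sum_def)
  then have X: "Ys ! j \<in> Obj C" if "j < ?n" for j using that nth_mem by blast
  obtain i p where cS: "\<forall>j < Suc ?n. i j \<in> carrier (Hom C ((Y # Ys) ! j) S) \<and> p j \<in> carrier (Hom C S ((Y # Ys) ! j))"
    and oS: "\<forall>j < Suc ?n. \<forall>l < Suc ?n. Comp C ((Y # Ys) ! l) S ((Y # Ys) ! j) (p j) (i l) =
          (if j = l then Idt C ((Y # Ys) ! j) else \<zero>\<^bsub>Hom C ((Y # Ys) ! l) ((Y # Ys) ! j)\<^esub>)"
    and sS: "(\<Oplus>\<^bsub>Hom C S S\<^esub> j \<in> {..<Suc ?n}. Comp C S ((Y # Ys) ! j) S (i j) (p j)) = Idt C S"
    using YS unfolding is_direct_sum_def by (auto simp del: nth_Cons_Suc)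
  obtain i' p' where i': "\<And>j. j < ?n \<Longrightarrow> i' j \<in> carrier (Hom C (Ys ! j) B)"
    and p': "\<And>j. j < ?n \<Longrightarrow> p' j \<in> carrier (Hom C B (Ys ! j))"
    and o': "\<And>j l. j < ?n \<Longrightarrow> l < ?n \<Longrightarrow> Comp C (Ys ! l) B (Ys ! j) (p' j) (i' l) =
          (if j = l then Idt C (Ys ! j) else \<zero>\<^bsub>Hom C (Ys ! l) (Ys ! j)\<^esub>)"
    and s': "(\<Oplus>\<^bsub>Hom C B B\<^esub> j \<in> {..<?n}. Comp C B (Ys ! j) B (i' j) (p' j)) = Idt C B"
    using B unfolding is_direct_sum_def by blast
  have i0: "i 0 \<in> carrier (Hom C Y S)" and p0: "p 0 \<in> carrier (Hom C S Y)"
    and i: "\<And>j. j < ?n \<Longrightarrow> i (Suc j) \<in> carrier (Hom C (Ys ! j) S)"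
    and p: "\<And>j. j < ?n \<Longrightarrow> p (Suc j) \<in> carrier (Hom C S (Ys ! j))"
    using cS[rule_format, of 0] cS[rule_format, of "Suc _"] by auto
  have o00: "Comp C Y S Y (p 0) (i 0) = Idt C Y"
    using oS[rule_format, of 0 0] by simp
  have o0: "Comp C (Ys ! l) S Y (p 0) (i (Suc l)) = \<zero>\<^bsub>Hom C (Ys ! l) Y\<^esub>" if "l < ?n" for l
    using that oS[rule_format, of 0 "Suc l"] by simp
  have o1: "Comp C Y S (Ys ! l) (p (Suc l)) (i 0) = \<zero>\<^bsub>Hom C Y (Ys ! l)\<^esub>" if "l < ?n" for l
    using that oS[rule_format, of "Suc l" 0] by simp
  have o: "Comp C (Ys ! l) S (Ys ! j) (p (Suc j)) (i (Suc l)) =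
          (if j = l then Idt C (Ys ! j) else \<zero>\<^bsub>Hom C (Ys ! l) (Ys ! j)\<^esub>)"
    if "j < ?n" "l < ?n" for j l
    using that oS[rule_format, of "Suc j" "Suc l"] by simp
  interpret SS: abelian_group "Hom C S S" using O by (intro abelian_group_Hom)
  interpret BB: abelian_group "Hom C B B" using O by (intro abelian_group_Hom)
  have s: "Comp C S Y S (i 0) (p 0) \<oplus>\<^bsub>Hom C S S\<^esub>
      (\<Oplus>\<^bsub>Hom C S S\<^esub> j \<in> {..<?n}. Comp C S (Ys ! j) S (i (Suc j)) (p (Suc j))) = Idt C S"
  proof -
    \<comment> \<open>Index 0 belongs to the head \<open>Y\<close>; the other indices are lowered by
      one to run over \<open>Ys\<close>.\<close>
    have "{..<Suc ?n} = insert 0 (Suc ` {..<?n})" by (auto simp: less_Suc_eq_0_disj)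
    then have "(\<Oplus>\<^bsub>Hom C S S\<^esub> j \<in> {..<Suc ?n}. Comp C S ((Y # Ys) ! j) S (i j) (p j)) =
        Comp C S Y S (i 0) (p 0) \<oplus>\<^bsub>Hom C S S\<^esub>
        (\<Oplus>\<^bsub>Hom C S S\<^esub> j \<in> Suc ` {..<?n}. Comp C S ((Y # Ys) ! j) S (i j) (p j))"
      using O X i0 p0 i p by (simp only:) (subst SS.finsum_insert, auto simp: Comp_closed)
    also have "(\<Oplus>\<^bsub>Hom C S S\<^esub> j \<in> Suc ` {..<?n}. Comp C S ((Y # Ys) ! j) S (i j) (p j)) =
        (\<Oplus>\<^bsub>Hom C S S\<^esub> j \<in> {..<?n}. Comp C S (Ys ! j) S (i (Suc j)) (p (Suc j)))"
      using O X i p by (subst SS.finsum_reindex) (auto simp: Comp_closed)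
    finally show ?thesis using sS by simp
  qed
  let ?\<iota> = "\<Oplus>\<^bsub>Hom C B S\<^esub> j \<in> {..<?n}. Comp C B (Ys ! j) S (i (Suc j)) (p' j)"
  let ?\<pi> = "\<Oplus>\<^bsub>Hom C S B\<^esub> j \<in> {..<?n}. Comp C S (Ys ! j) B (i' j) (p (Suc j))"
  have \<iota>: "?\<iota> \<in> carrier (Hom C B S)" and \<pi>: "?\<pi> \<in> carrier (Hom C S B)"
    using O X i i' p p' by (auto intro!: Hom_finsum_closed Comp_closed)
  \<comment> \<open>By orthogonality only the term \<open>l = j\<close> survives. This equation and
    its counterpart for \<open>p'\<close> exchange the projections of \<open>S\<close> and
    \<open>B\<close>, so that the sums below collapse to the decompositions of the two
    identities.\<close>
  have p\<iota>: "Comp C B S (Ys ! j) (p (Suc j)) ?\<iota> = p' j" if j: "j < ?n" for j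
  proof -
    interpret BY: abelian_group "Hom C B (Ys ! j)" using O X j by (intro abelian_group_Hom)
    have "Comp C B S (Ys ! j) (p (Suc j)) ?\<iota> = (\<Oplus>\<^bsub>Hom C B (Ys ! j)\<^esub> l \<in> {..<?n}.
        Comp C B S (Ys ! j) (p (Suc j)) (Comp C B (Ys ! l) S (i (Suc l)) (p' l)))"
      using O X i p p' j by (intro Comp_finsum_right) (auto simp: Comp_closed)
    also have "\<dots> = (\<Oplus>\<^bsub>Hom C B (Ys ! j)\<^esub> l \<in> {..<?n}. if j = l then p' j else \<zero>\<^bsub>Hom C B (Ys ! j)\<^esub>)"
      using O X i p p' j o by (intro BY.finsum_cong') (auto simp: Comp_assoc Idt_left Comp_zero_left)
    also have "\<dots> = p' j"
      using j p' by (intro BY.add.finprod_singleton) auto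
    finally show ?thesis .
  qed
  have p'\<pi>: "Comp C S B (Ys ! j) (p' j) ?\<pi> = p (Suc j)" if j: "j < ?n" for j
  proof -
    interpret SY: abelian_group "Hom C S (Ys ! j)" using O X j by (intro abelian_group_Hom)
    have "Comp C S B (Ys ! j) (p' j) ?\<pi> = (\<Oplus>\<^bsub>Hom C S (Ys ! j)\<^esub> l \<in> {..<?n}.
        Comp C S B (Ys ! j) (p' j) (Comp C S (Ys ! l) B (i' l) (p (Suc l))))"
      using O X i' p p' j by (intro Comp_finsum_right) (auto simp: Comp_closed)
    also have "\<dots> = (\<Oplus>\<^bsub>Hom C S (Ys ! j)\<^esub> l \<in> {..<?n}. if j = l then p (Suc j) else \<zero>\<^bsub>Hom C S (Ys ! j)\<^esub>)"
      using O X i' p p' j o' by (intro SY.finsum_cong') (auto simp: Comp_assoc Idt_left Comp_zero_left)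
    also have "\<dots> = p (Suc j)"
      using j p by (intro SY.add.finprod_singleton) auto
    finally show ?thesis .
  qed
  show ?thesis
  proof (rule is_direct_sum_pairI[of Y B S "i 0" ?\<iota> "p 0" ?\<pi>])
    have "Comp C B S B ?\<pi> ?\<iota> = (\<Oplus>\<^bsub>Hom C B B\<^esub> j \<in> {..<?n}.
        Comp C B S B (Comp C S (Ys ! j) B (i' j) (p (Suc j))) ?\<iota>)"
      using O X i' p \<iota> by (intro Comp_finsum_left) (auto simp: Comp_closed)
    also have "\<dots> = (\<Oplus>\<^bsub>Hom C B B\<^esub> j \<in> {..<?n}. Comp C B (Ys ! j) B (i' j) (p' j))"
      using O X i' p p' \<iota> p\<iota> by (intro BB.finsum_cong') (auto simp: Comp_assoc[symmetric] Comp_closed)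
    finally show "Comp C B S B ?\<pi> ?\<iota> = Idt C B" using s' by simp
    interpret BY: abelian_group "Hom C B Y" using O by (intro abelian_group_Hom)
    interpret YB: abelian_group "Hom C Y B" using O by (intro abelian_group_Hom)
    have "Comp C B S Y (p 0) ?\<iota> = (\<Oplus>\<^bsub>Hom C B Y\<^esub> l \<in> {..<?n}.
        Comp C B S Y (p 0) (Comp C B (Ys ! l) S (i (Suc l)) (p' l)))"
      using O X i p0 p' by (intro Comp_finsum_right) (auto simp: Comp_closed)
    also have "\<dots> = (\<Oplus>\<^bsub>Hom C B Y\<^esub> l \<in> {..<?n}. \<zero>\<^bsub>Hom C B Y\<^esub>)"
      using O X i p0 p' o0 by (intro BY.finsum_cong') (auto simp: Comp_assoc Comp_zero_left)
    finally show "Comp C B S Y (p 0) ?\<iota> = \<zero>\<^bsub>Hom C B Y\<^esub>" by simp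
    have "Comp C Y S B ?\<pi> (i 0) = (\<Oplus>\<^bsub>Hom C Y B\<^esub> j \<in> {..<?n}.
        Comp C Y S B (Comp C S (Ys ! j) B (i' j) (p (Suc j))) (i 0))"
      using O X i' p i0 by (intro Comp_finsum_left) (auto simp: Comp_closed)
    also have "\<dots> = (\<Oplus>\<^bsub>Hom C Y B\<^esub> j \<in> {..<?n}. \<zero>\<^bsub>Hom C Y B\<^esub>)"
      using O X i' p i0 o1 by (intro YB.finsum_cong') (auto simp: Comp_assoc[symmetric] Comp_zero_right)
    finally show "Comp C Y S B ?\<pi> (i 0) = \<zero>\<^bsub>Hom C Y B\<^esub>" by simp
    have "Comp C S B S ?\<iota> ?\<pi> = (\<Oplus>\<^bsub>Hom C S S\<^esub> j \<in> {..<?n}.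
        Comp C S B S (Comp C B (Ys ! j) S (i (Suc j)) (p' j)) ?\<pi>)"
      using O X i p' \<pi> by (intro Comp_finsum_left) (auto simp: Comp_closed)
    also have "\<dots> = (\<Oplus>\<^bsub>Hom C S S\<^esub> j \<in> {..<?n}. Comp C S (Ys ! j) S (i (Suc j)) (p (Suc j)))"
      using O X i p p' \<pi> p'\<pi> by (intro SS.finsum_cong') (auto simp: Comp_assoc[symmetric] Comp_closed)
    finally show "Comp C S Y S (i 0) (p 0) \<oplus>\<^bsub>Hom C S S\<^esub> Comp C S B S ?\<iota> ?\<pi> = Idt C S"
      using s by simp
  qed (use O i0 p0 \<iota> \<pi> o00 in auto)
qed

text \<open>Additivity provides a sum \<open>B\<close> of the tail, so that \<open>N\<close> is the
  sum of the head and \<open>B\<close>. One of the two is zero, and the other is then isomorphic to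
  \<open>N\<close>.\<close>

lemma indecomposable_isomorphic_summand:
  assumes "additive_category C" and N: "indecomposable C N"
  shows "is_direct_sum C Ys N \<Longrightarrow> \<exists>Y \<in> set Ys. isomorphic C Y N"
proof (induction Ys)
  case Nil
  then have O: "N \<in> Obj C" by (simp add: is_direct_sum_def)
  then interpret abelian_group "Hom C N N" by (intro abelian_group_Hom)
  \<comment> \<open>The empty sum of endomorphisms is zero, so \<open>N\<close> would be a zero
    object.\<close>
  have "Idt C N = \<zero>\<^bsub>Hom C N N\<^esub>"
    using Nil by (auto simp: is_direct_sum_def)
  then show ?case using O N zero_object_iff by (auto simp: indecomposable_def)
next
  case (Cons Y Ys)
  then have "set Ys \<subseteq> Obj C" by (auto simp: is_direct_sum_def)
  then obtain B where B: "is_direct_sum C Ys B"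
    using assms(1) by (auto simp: additive_category_def)
  then have YB: "is_direct_sum C [Y, B] N" using Cons.prems is_direct_sum_Cons by blast
  with N have "zero_object C Y \<or> zero_object C B" by (auto simp: indecomposable_def)
  then show ?case
  proof
    assume "zero_object C Y"
    \<comment> \<open>With a zero head, the tail alone already sums to \<open>N\<close>.\<close>
    with YB have "isomorphic C B N" by (rule direct_sum_zero_left_isomorphic)
    with B have "is_direct_sum C Ys N" by (rule is_direct_sum_isomorphic)
    then show ?thesis using Cons.IH by auto
  next
    assume "zero_object C B"
    with YB show ?thesis using direct_sum_zero_right_isomorphic by auto
  qed
qed

section \<open>Scalar endomorphisms\<close>

lemma End_scalar_closed: "M \<in> Obj C \<Longrightarrow> x \<in> carrier K \<Longrightarrow> End_scalar C M x \<in> carrier (Hom C M M)"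
  by (simp add: End_scalar_def Hom_smult_closed Idt_closed)

lemma Comp_End_scalar_right:
  "M \<in> Obj C \<Longrightarrow> N \<in> Obj C \<Longrightarrow> f \<in> carrier (Hom C M N) \<Longrightarrow> x \<in> carrier K \<Longrightarrow>
    Comp C M M N f (End_scalar C M x) = x \<odot>\<^bsub>Hom C M N\<^esub> f"
  by (simp add: End_scalar_def Comp_smult_right Idt_closed Idt_right)

lemma Comp_End_scalar_left:
  "M \<in> Obj C \<Longrightarrow> N \<in> Obj C \<Longrightarrow> f \<in> carrier (Hom C M N) \<Longrightarrow> x \<in> carrier K \<Longrightarrow>
    Comp C M N N (End_scalar C N x) f = x \<odot>\<^bsub>Hom C M N\<^esub> f"
  by (simp add: End_scalar_def Comp_smult_left Idt_closed Idt_left)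

lemma Hom_smult_cancel:
  assumes "M \<in> Obj C" "N \<in> Obj C" "x \<in> carrier K" "y \<in> carrier K"
    and "f \<in> carrier (Hom C M N)" "f \<noteq> \<zero>\<^bsub>Hom C M N\<^esub>" "x \<odot>\<^bsub>Hom C M N\<^esub> f = y \<odot>\<^bsub>Hom C M N\<^esub> f"
  shows "x = y"
  using vectorspace.smult_cancel[OF vectorspace_Hom] assms by metis

lemma Hom_zero_smult:
  "M \<in> Obj C \<Longrightarrow> N \<in> Obj C \<Longrightarrow> f \<in> carrier (Hom C M N) \<Longrightarrow>
    \<zero>\<^bsub>K\<^esub> \<odot>\<^bsub>Hom C M N\<^esub> f = \<zero>\<^bsub>Hom C M N\<^esub>"
  using vectorspace_Hom[of M N] unfolding vectorspace_def by (simp add: module.lmult_0)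

lemma Hom_one_smult:
  "M \<in> Obj C \<Longrightarrow> N \<in> Obj C \<Longrightarrow> f \<in> carrier (Hom C M N) \<Longrightarrow>
    \<one>\<^bsub>K\<^esub> \<odot>\<^bsub>Hom C M N\<^esub> f = f"
  using vectorspace_Hom[of M N] unfolding vectorspace_def by (simp add: module.smult_one)

lemma Hom_smult_assoc:
  "M \<in> Obj C \<Longrightarrow> N \<in> Obj C \<Longrightarrow> f \<in> carrier (Hom C M N) \<Longrightarrow> x \<in> carrier K \<Longrightarrow> y \<in> carrier K \<Longrightarrow>
    (x \<otimes>\<^bsub>K\<^esub> y) \<odot>\<^bsub>Hom C M N\<^esub> f = x \<odot>\<^bsub>Hom C M N\<^esub> (y \<odot>\<^bsub>Hom C M N\<^esub> f)"
  using vectorspace_Hom[of M N] unfolding vectorspace_def by (simp add: module.smult_assoc1)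

lemma Hom_smult_l_distr:
  "M \<in> Obj C \<Longrightarrow> N \<in> Obj C \<Longrightarrow> f \<in> carrier (Hom C M N) \<Longrightarrow> x \<in> carrier K \<Longrightarrow> y \<in> carrier K \<Longrightarrow>
    (x \<oplus>\<^bsub>K\<^esub> y) \<odot>\<^bsub>Hom C M N\<^esub> f = x \<odot>\<^bsub>Hom C M N\<^esub> f \<oplus>\<^bsub>Hom C M N\<^esub> y \<odot>\<^bsub>Hom C M N\<^esub> f"
  using vectorspace_Hom[of M N] unfolding vectorspace_def by (simp add: module.smult_l_distr)

end


section \<open>Bricks\<close>

definition brick :: "'k ring \<Rightarrow> ('o, 'm, 'k, 'z) category_data_scheme \<Rightarrow> 'o \<Rightarrow> bool" where
  "brick K C M \<longleftrightarrow> M \<in> Obj C \<and> \<not> zero_object C M \<and>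
     (\<forall>f \<in> carrier (Hom C M M). \<exists>x \<in> carrier K. f = End_scalar C M x)"

context linear_category
begin

lemma End_scalar_zero: "M \<in> Obj C \<Longrightarrow> End_scalar C M \<zero>\<^bsub>K\<^esub> = \<zero>\<^bsub>Hom C M M\<^esub>"
  by (simp add: End_scalar_def Hom_zero_smult Idt_closed)

lemma End_scalar_one: "M \<in> Obj C \<Longrightarrow> End_scalar C M \<one>\<^bsub>K\<^esub> = Idt C M"
  by (simp add: End_scalar_def Hom_one_smult Idt_closed)

lemma End_scalar_inj:
  assumes "M \<in> Obj C" "\<not> zero_object C M" "x \<in> carrier K" "y \<in> carrier K"
    and "End_scalar C M x = End_scalar C M y"
  shows "x = y"
  using assms Hom_smult_cancel[of M M x y "Idt C M"] zero_object_iff[of M] Idt_closed[of M]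
  by (simp add: End_scalar_def)

text \<open>Surjectivity of the structure map is the condition on endomorphisms. Injectivity
  corresponds to \<open>M\<close> being nonzero: in a zero object the scalars 0 and 1 act alike, and
  in a nonzero one a nonzero identity allows cancellation.\<close>

lemma brick_iff_End_scalar_iso:
  assumes M: "M \<in> Obj C"
  shows "End_scalar C M \<in> ring_iso K (End_ring C M) \<longleftrightarrow> brick K C M"
proof
  interpret field K by (rule field_K)
  assume iso: "End_scalar C M \<in> ring_iso K (End_ring C M)"
  then have b: "bij_betw (End_scalar C M) (carrier K) (carrier (Hom C M M))"
    by (auto simp: ring_iso_def End_ring_def)
  have "\<not> zero_object C M"
  proof
    assume "zero_object C M"
    then have "End_scalar C M \<zero>\<^bsub>K\<^esub> = End_scalar C M \<one>\<^bsub>K\<^esub>"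
      using M by (simp add: End_scalar_zero End_scalar_one zero_object_iff)
    then show False
      using b inj_onD[of "End_scalar C M" "carrier K" "\<zero>\<^bsub>K\<^esub>" "\<one>\<^bsub>K\<^esub>"] zero_not_one
      by (simp add: bij_betw_def)
  qed
  with b M show "brick K C M" unfolding brick_def bij_betw_def by blast
next
  interpret field K by (rule field_K)
  assume b: "brick K C M"
  then have "inj_on (End_scalar C M) (carrier K)"
    by (auto simp: brick_def inj_on_def dest: End_scalar_inj)
  moreover have "End_scalar C M ` carrier K = carrier (Hom C M M)"
    using b M End_scalar_closed unfolding brick_def by blast
  moreover have "End_scalar C M \<in> ring_hom K (End_ring C M)"
  proof (rule ring_hom_memI)
    fix x y assume xy: "x \<in> carrier K" "y \<in> carrier K"
    have "End_scalar C M (x \<otimes>\<^bsub>K\<^esub> y) = x \<odot>\<^bsub>Hom C M M\<^esub> End_scalar C M y"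
      using M xy by (simp add: End_scalar_def Hom_smult_assoc Idt_closed)
    also have "\<dots> = Comp C M M M (End_scalar C M x) (End_scalar C M y)"
      using M xy by (simp add: Comp_End_scalar_left End_scalar_closed)
    finally show "End_scalar C M (x \<otimes>\<^bsub>K\<^esub> y) = End_scalar C M x \<otimes>\<^bsub>End_ring C M\<^esub> End_scalar C M y"
      by (simp add: End_ring_def)
    show "End_scalar C M (x \<oplus>\<^bsub>K\<^esub> y) = End_scalar C M x \<oplus>\<^bsub>End_ring C M\<^esub> End_scalar C M y"
      using M xy by (simp add: End_ring_def End_scalar_def Hom_smult_l_distr Idt_closed)
  qed (use M in \<open>auto simp: End_ring_def End_scalar_one End_scalar_closed\<close>)
  ultimately show "End_scalar C M \<in> ring_iso K (End_ring C M)"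
    by (simp add: ring_iso_def bij_betw_def End_ring_def)
qed

text \<open>The idempotent \<open>iA pA\<close> is a scalar \<open>x\<close>. If
  \<open>x = 0\<close>, then \<open>iA = (iA pA) iA = 0\<close>, so \<open>A\<close> is zero.
  Otherwise \<open>x pB = pB (iA pA) = 0\<close> forces \<open>pB = 0\<close>, so \<open>B\<close>
  is zero.\<close>

lemma brick_indecomposable:
  assumes M: "brick K C M"
  shows "indecomposable C M"
  unfolding indecomposable_def
proof (intro conjI allI impI)
  show "M \<in> Obj C" "\<not> zero_object C M" using M by (auto simp: brick_def)
  fix A B assume "is_direct_sum C [A, B] M"
  then show "zero_object C A \<or> zero_object C B"
  proof (rule is_direct_sum_pairE)
    interpret field K by (rule field_K)
    fix iA iB pA pB
    assume O: "A \<in> Obj C" "B \<in> Obj C" "M \<in> Obj C"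
      and cl: "iA \<in> carrier (Hom C A M)" "iB \<in> carrier (Hom C B M)"
        "pA \<in> carrier (Hom C M A)" "pB \<in> carrier (Hom C M B)"
      and id: "Comp C A M A pA iA = Idt C A" "Comp C B M B pB iB = Idt C B"
      and 0: "Comp C A M B pB iA = \<zero>\<^bsub>Hom C A B\<^esub>"
    let ?e = "Comp C M A M iA pA"
    have "?e \<in> carrier (Hom C M M)" using O cl by (intro Comp_closed)
    then obtain x where x: "x \<in> carrier K" "?e = End_scalar C M x"
      using M by (auto simp: brick_def)
    show ?thesis
    proof (cases "x = \<zero>\<^bsub>K\<^esub>")
      case True
      have "Comp C A M M ?e iA = Comp C A A M iA (Comp C A M A pA iA)"
        using O cl by (intro Comp_assoc[symmetric])
      then have "iA = \<zero>\<^bsub>Hom C A M\<^esub>"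
        using O cl id x True by (simp add: Idt_right Comp_End_scalar_left Hom_zero_smult)
      then show ?thesis using id O cl by (simp add: zero_object_iff Comp_zero_right)
    next
      case False
      have "Comp C M M B pB ?e = Comp C M A B (Comp C A M B pB iA) pA"
        using O cl by (intro Comp_assoc)
      then have "x \<odot>\<^bsub>Hom C M B\<^esub> pB = \<zero>\<^bsub>K\<^esub> \<odot>\<^bsub>Hom C M B\<^esub> pB"
        using O cl x 0 by (simp add: Comp_End_scalar_right Comp_zero_left Hom_zero_smult)
      then have "pB = \<zero>\<^bsub>Hom C M B\<^esub>"
        using O cl x False Hom_smult_cancel[of M B x "\<zero>\<^bsub>K\<^esub>" pB] by auto
      then show ?thesis using id O cl by (simp add: zero_object_iff Comp_zero_left)
    qed
  qed
qed

text \<open>An endomorphism \<open>u\<close> of \<open>N\<close> is carried to \<open>g u f\<close>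
  on \<open>M\<close>, which is a scalar; conjugating back gives the same scalar on
  \<open>N\<close>.\<close>

lemma brick_isomorphic:
  assumes M: "brick K C M" and "isomorphic C M N"
  shows "brick K C N"
  unfolding brick_def
proof (intro conjI ballI)
  have O: "M \<in> Obj C" "N \<in> Obj C" using assms by (auto simp: isomorphic_def)
  show "N \<in> Obj C" by fact
  show "\<not> zero_object C N"
    using assms zero_object_isomorphic isomorphic_sym by (auto simp: brick_def)
  obtain f g where f: "f \<in> carrier (Hom C M N)" and g: "g \<in> carrier (Hom C N M)"
    and fg: "Comp C N M N f g = Idt C N"
    using assms(2) by (auto simp: isomorphic_def inverse_morphisms_def)
  fix u assume u: "u \<in> carrier (Hom C N N)"
  have "Comp C M N M g (Comp C M N N u f) \<in> carrier (Hom C M M)"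
    using O f g u by (intro Comp_closed)
  then obtain x where x: "x \<in> carrier K" "Comp C M N M g (Comp C M N N u f) = End_scalar C M x"
    using M unfolding brick_def by blast
  have "u = Comp C N M N (Comp C M N N u f) g"
    using Comp_assoc[of N M N N g f u] O f g u fg by (simp add: Idt_right)
  also have "\<dots> = Comp C N N N (Comp C N M N f g) (Comp C N M N (Comp C M N N u f) g)"
    using O f g u fg by (simp add: Idt_left Comp_closed)
  also have "\<dots> = Comp C N M N f (Comp C N N M g (Comp C N M N (Comp C M N N u f) g))"
    using O f g u by (intro Comp_assoc[symmetric] Comp_closed)
  also have "Comp C N N M g (Comp C N M N (Comp C M N N u f) g) =
      Comp C N M M (Comp C M N M g (Comp C M N N u f)) g"
    using O f g u by (intro Comp_assoc Comp_closed)
  also have "Comp C N M N f (Comp C N M M (Comp C M N M g (Comp C M N N u f)) g) = End_scalar C N x"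
    using O f g x fg by (simp add: Comp_End_scalar_left Comp_smult_right End_scalar_def[of C N])
  finally show "\<exists>x \<in> carrier K. u = End_scalar C N x" using x by blast
qed

text \<open>A single nonzero composite suffices: it is an invertible scalar, so \<open>f\<close> has
  a left inverse, and since endomorphisms of \<open>N\<close> are scalar too, this left inverse is
  two-sided.\<close>

lemma bricks_isomorphicI:
  assumes M: "brick K C M" and N: "brick K C N"
    and f: "f \<in> carrier (Hom C M N)" and g: "g \<in> carrier (Hom C N M)"
    and nz: "Comp C M N M g f \<noteq> \<zero>\<^bsub>Hom C M M\<^esub>"
  shows "isomorphic C M N"
proof -
  interpret field K by (rule field_K)
  have O: "M \<in> Obj C" "N \<in> Obj C" using M N by (auto simp: brick_def)
  obtain x where x: "x \<in> carrier K" "Comp C M N M g f = End_scalar C M x"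
    using M O f g unfolding brick_def by (metis Comp_closed)
  have x0: "x \<noteq> \<zero>\<^bsub>K\<^esub>" using nz x O by (auto simp: End_scalar_zero)
  then have ix: "inv\<^bsub>K\<^esub> x \<in> carrier K" "inv\<^bsub>K\<^esub> x \<otimes>\<^bsub>K\<^esub> x = \<one>\<^bsub>K\<^esub>"
    using x field_Units by auto
  \<comment> \<open>Rescaling turns \<open>g f = x id\<close> into a left inverse of
    \<open>f\<close>.\<close>
  let ?g = "inv\<^bsub>K\<^esub> x \<odot>\<^bsub>Hom C N M\<^esub> g"
  have g': "?g \<in> carrier (Hom C N M)" using O g ix by (intro Hom_smult_closed)
  have gf: "Comp C M N M ?g f = Idt C M"
  proof -
    have "Comp C M N M ?g f = inv\<^bsub>K\<^esub> x \<odot>\<^bsub>Hom C M M\<^esub> End_scalar C M x"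
      using O f g ix x by (simp add: Comp_smult_left)
    also have "\<dots> = End_scalar C M (inv\<^bsub>K\<^esub> x \<otimes>\<^bsub>K\<^esub> x)"
      using O ix(1) x by (simp add: End_scalar_def Hom_smult_assoc Idt_closed)
    finally show ?thesis using O ix by (simp add: End_scalar_one)
  qed
  obtain z where z: "z \<in> carrier K" "Comp C N M N f ?g = End_scalar C N z"
    using N O f g' unfolding brick_def by (metis Comp_closed)
  have f0: "f \<noteq> \<zero>\<^bsub>Hom C M N\<^esub>"
    using nz O g by (auto simp: Comp_zero_right)
  \<comment> \<open>Both sides of \<open>(f g') f = f (g' f)\<close> are multiples of the nonzero
    \<open>f\<close>, which gives \<open>z = 1\<close>; here \<open>g'\<close> is the rescaled
    \<open>g\<close>.\<close>
  have "z \<odot>\<^bsub>Hom C M N\<^esub> f = Comp C M N N (Comp C N M N f ?g) f"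
    using O f z by (simp add: Comp_End_scalar_left)
  also have "\<dots> = Comp C M M N f (Comp C M N M ?g f)"
    using O f g' by (intro Comp_assoc[symmetric])
  also have "\<dots> = \<one>\<^bsub>K\<^esub> \<odot>\<^bsub>Hom C M N\<^esub> f"
    using O f gf by (simp add: Idt_right Hom_one_smult)
  finally have "z = \<one>\<^bsub>K\<^esub>"
    using O f f0 z by (intro Hom_smult_cancel[of M N z "\<one>\<^bsub>K\<^esub>" f]) auto
  then have "Comp C N M N f ?g = Idt C N" using z O by (simp add: End_scalar_one)
  then show ?thesis
    unfolding isomorphic_def inverse_morphisms_def using O f g' gf by blast
qed

text \<open>The idempotents of two complementary summands add up to 1. Nonunits are closed under
  addition and do not contain 1, so one idempotent is a unit and hence equals 1; the complementary
  summand is then zero.\<close>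

lemma local_End_ring_indecomposable:
  assumes M: "M \<in> Obj C" and loc: "is_local_ring (End_ring C M)"
  shows "indecomposable C M"
proof -
  let ?R = "End_ring C M"
  interpret ring ?R using loc by (simp add: is_local_ring_def)
  interpret ideal "nonunits ?R" ?R using loc by (simp add: is_local_ring_def)
  have one: "\<one>\<^bsub>?R\<^esub> \<notin> nonunits ?R" by (simp add: nonunits_def)
  \<comment> \<open>Stated for general inclusions and projections, since it is applied a second time
    with the two summands exchanged.\<close>
  have key: "zero_object C B"
    if O: "A \<in> Obj C" "B \<in> Obj C"
      and cl: "iA \<in> carrier (Hom C A M)" "iB \<in> carrier (Hom C B M)"
        "pA \<in> carrier (Hom C M A)" "pB \<in> carrier (Hom C M B)"
      and id: "Comp C A M A pA iA = Idt C A" "Comp C B M B pB iB = Idt C B"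
      and 0: "Comp C A M B pB iA = \<zero>\<^bsub>Hom C A B\<^esub>"
      and U: "Comp C M A M iA pA \<in> Units ?R" for A B iA iB pA pB
  proof -
    let ?e = "Comp C M A M iA pA"
    have e: "?e \<in> carrier ?R" using U by blast
    \<comment> \<open>Idempotence from \<open>pA iA = id\<close>; cancelling the unit
      \<open>e\<close> in \<open>e e = e 1\<close> leaves \<open>e = 1\<close>.\<close>
    have "Comp C M M M ?e ?e = Comp C M A M (Comp C A M M ?e iA) pA"
      using O M cl by (intro Comp_assoc Comp_closed)
    also have "Comp C A M M ?e iA = Comp C A A M iA (Comp C A M A pA iA)"
      using O M cl by (intro Comp_assoc[symmetric])
    finally have "?e \<otimes>\<^bsub>?R\<^esub> ?e = ?e"
      using O M cl id by (simp add: Idt_right End_ring_def)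
    then have "?e \<otimes>\<^bsub>?R\<^esub> ?e = ?e \<otimes>\<^bsub>?R\<^esub> \<one>\<^bsub>?R\<^esub>" using e by (simp only: r_one)
    then have "?e = \<one>\<^bsub>?R\<^esub>"
      using U e Units_l_cancel[of ?e ?e "\<one>\<^bsub>?R\<^esub>"] by blast
    then have "?e = Idt C M" by (simp add: End_ring_def)
    moreover have "Comp C M M B pB ?e = Comp C M A B (Comp C A M B pB iA) pA"
      using O M cl by (intro Comp_assoc)
    ultimately have "pB = \<zero>\<^bsub>Hom C M B\<^esub>"
      using O M cl 0 by (simp add: Idt_right Comp_zero_left)
    then show ?thesis using id O M cl by (simp add: zero_object_iff Comp_zero_left)
  qed
  show ?thesis
    unfolding indecomposable_def
  proof (intro conjI allI impI)
    show "\<not> zero_object C M"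
    proof
      assume "zero_object C M"
      then have "\<one>\<^bsub>?R\<^esub> = \<zero>\<^bsub>?R\<^esub>" using M by (simp add: zero_object_iff End_ring_def)
      \<comment> \<open>If 1 were 0, it would lie in the ideal of nonunits.\<close>
      then show False using one additive_subgroup.zero_closed[OF is_additive_subgroup] by simp
    qed
    fix A B assume "is_direct_sum C [A, B] M"
    then show "zero_object C A \<or> zero_object C B"
    proof (rule is_direct_sum_pairE)
      fix iA iB pA pB
      assume O: "A \<in> Obj C" "B \<in> Obj C"
        and cl: "iA \<in> carrier (Hom C A M)" "iB \<in> carrier (Hom C B M)"
          "pA \<in> carrier (Hom C M A)" "pB \<in> carrier (Hom C M B)"
        and id: "Comp C A M A pA iA = Idt C A" "Comp C B M B pB iB = Idt C B"
        and 0: "Comp C B M A pA iB = \<zero>\<^bsub>Hom C B A\<^esub>" "Comp C A M B pB iA = \<zero>\<^bsub>Hom C A B\<^esub>"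
        and s: "Comp C M A M iA pA \<oplus>\<^bsub>Hom C M M\<^esub> Comp C M B M iB pB = Idt C M"
      have "Comp C M A M iA pA \<in> carrier ?R" "Comp C M B M iB pB \<in> carrier ?R"
        using O M cl by (auto simp: End_ring_def Comp_closed)
      moreover have "Comp C M A M iA pA \<oplus>\<^bsub>?R\<^esub> Comp C M B M iB pB = \<one>\<^bsub>?R\<^esub>"
        using s by (simp add: End_ring_def)
      ultimately have "Comp C M A M iA pA \<in> Units ?R \<or> Comp C M B M iB pB \<in> Units ?R"
        using one additive_subgroup.a_closed[OF is_additive_subgroup] unfolding nonunits_def
        by (metis DiffI)
      then show ?thesis
        using key[OF O cl id 0(2)] key[OF O(2,1) cl(2,1,4,3) id(2,1) 0(1)] by blast
    qed
  qed (rule M)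
qed

end

section \<open>Opposite categories\<close>

lemma op_cat_simps [simp]:
  "Obj (op_cat C) = Obj C" "Hom (op_cat C) M N = Hom C N M"
  "Comp (op_cat C) M N P g f = Comp C P N M f g" "Idt (op_cat C) = Idt C"
  by (simp_all add: op_cat_def)

lemma isomorphic_op_cat: "isomorphic (op_cat C) M N \<longleftrightarrow> isomorphic C M N"
  by (auto simp: isomorphic_def inverse_morphisms_def)

text \<open>Self-duality of the notion lets results on covariant functors be applied to the duality,
  viewed as a functor on the opposite category.\<close>

lemma brick_op_cat: "brick K (op_cat C) M \<longleftrightarrow> brick K C M"
  by (auto simp: brick_def zero_object_def zero_Hom_def End_scalar_def)


section \<open>Linear functors\<close>

context linear_functor
begin

lemma FMap_closed:
  assumes "M \<in> Obj C" "N \<in> Obj C" "f \<in> carrier (Hom C M N)"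
  shows "FMap F M N f \<in> carrier (Hom D (FObj F M) (FObj F N))"
proof -
  interpret linear_map K "Hom C M N" "Hom D (FObj F M) (FObj F N)" "FMap F M N"
    using assms by (intro FMap_linear)
  show ?thesis using assms T_im by blast
qed

lemma FMap_zero:
  assumes "M \<in> Obj C" "N \<in> Obj C"
  shows "FMap F M N \<zero>\<^bsub>Hom C M N\<^esub> = \<zero>\<^bsub>Hom D (FObj F M) (FObj F N)\<^esub>"
proof -
  interpret linear_map K "Hom C M N" "Hom D (FObj F M) (FObj F N)" "FMap F M N"
    using assms by (intro FMap_linear)
  show ?thesis by (rule T0_is_0)
qed

lemma FMap_End_scalar:
  assumes "M \<in> Obj C" "x \<in> carrier K"
  shows "FMap F M M (End_scalar C M x) = End_scalar D (FObj F M) x"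
proof -
  interpret linear_map K "Hom C M M" "Hom D (FObj F M) (FObj F M)" "FMap F M M"
    using assms by (intro FMap_linear)
  show ?thesis
    unfolding End_scalar_def using assms T_smult[OF assms(2) dom.Idt_closed[OF assms(1)]]
    by (simp add: FMap_Idt)
qed

lemma FMap_finsum:
  assumes "M \<in> Obj C" "N \<in> Obj C" "finite A" "h \<in> A \<rightarrow> carrier (Hom C M N)"
  shows "FMap F M N (\<Oplus>\<^bsub>Hom C M N\<^esub>a\<in>A. h a) = (\<Oplus>\<^bsub>Hom D (FObj F M) (FObj F N)\<^esub>a\<in>A. FMap F M N (h a))"
proof -
  interpret linear_map K "Hom C M N" "Hom D (FObj F M) (FObj F N)" "FMap F M N"
    using assms by (intro FMap_linear)
  show ?thesis using assms by (intro T_finsum)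
qed

lemma FObj_isomorphic:
  assumes "isomorphic C M N"
  shows "isomorphic D (FObj F M) (FObj F N)"
proof -
  have O: "M \<in> Obj C" "N \<in> Obj C" using assms by (auto simp: isomorphic_def)
  obtain f g where "f \<in> carrier (Hom C M N)" "g \<in> carrier (Hom C N M)"
    "Comp C M N M g f = Idt C M" "Comp C N M N f g = Idt C N"
    using assms by (auto simp: isomorphic_def inverse_morphisms_def)
  then have "inverse_morphisms D (FObj F M) (FObj F N) (FMap F M N f) (FMap F N M g)"
    unfolding inverse_morphisms_def using O
    by (auto simp: FMap_closed FMap_Comp[symmetric] FMap_Idt)
  then show ?thesis using O FObj_closed by (auto simp: isomorphic_def)
qed

lemma FObj_zero_object:
  assumes "zero_object C M"
  shows "zero_object D (FObj F M)"
proof -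
  have O: "M \<in> Obj C" using assms by (simp add: zero_object_def)
  then have "Idt D (FObj F M) = FMap F M M (Idt C M)" by (simp add: FMap_Idt)
  also have "\<dots> = \<zero>\<^bsub>Hom D (FObj F M) (FObj F M)\<^esub>"
    using O assms by (simp add: dom.zero_object_iff FMap_zero)
  finally show ?thesis using O by (simp add: cod.zero_object_iff FObj_closed)
qed

text \<open>Biproducts are characterised by equations between morphisms, with sums and zeros, all of
  which a linear functor respects.\<close>

lemma FObj_is_direct_sum:
  assumes "is_direct_sum C Xs S"
  shows "is_direct_sum D (map (FObj F) Xs) (FObj F S)"
proof -
  have O: "set Xs \<subseteq> Obj C" "S \<in> Obj C" using assms by (auto simp: is_direct_sum_def)
  then have X: "Xs ! j \<in> Obj C" if "j < length Xs" for j using that nth_mem by blast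
  obtain i p where i: "\<And>j. j < length Xs \<Longrightarrow> i j \<in> carrier (Hom C (Xs ! j) S)"
    and p: "\<And>j. j < length Xs \<Longrightarrow> p j \<in> carrier (Hom C S (Xs ! j))"
    and o: "\<And>j l. j < length Xs \<Longrightarrow> l < length Xs \<Longrightarrow> Comp C (Xs ! l) S (Xs ! j) (p j) (i l) =
          (if j = l then Idt C (Xs ! j) else \<zero>\<^bsub>Hom C (Xs ! l) (Xs ! j)\<^esub>)"
    and s: "(\<Oplus>\<^bsub>Hom C S S\<^esub> j \<in> {..<length Xs}. Comp C S (Xs ! j) S (i j) (p j)) = Idt C S"
    using assms unfolding is_direct_sum_def by blast
  let ?i = "\<lambda>j. FMap F (Xs ! j) S (i j)"
  let ?p = "\<lambda>j. FMap F S (Xs ! j) (p j)"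
  let ?S = "FObj F S" and ?X = "\<lambda>j. FObj F (Xs ! j)"
  have FS: "?S \<in> Obj D" using O FObj_closed by blast
  interpret abelian_group "Hom D ?S ?S" using FS by (intro cod.abelian_group_Hom)
  have "Comp D (?X l) ?S (?X j) (?p j) (?i l) =
      (if j = l then Idt D (?X j) else \<zero>\<^bsub>Hom D (?X l) (?X j)\<^esub>)"
    if "j < length Xs" "l < length Xs" for j l
    using that O X i p o by (simp add: FMap_Comp[symmetric] FMap_Idt FMap_zero)
  moreover have "(\<Oplus>\<^bsub>Hom D ?S ?S\<^esub> j \<in> {..<length Xs}. Comp D ?S (?X j) ?S (?i j) (?p j)) = Idt D ?S"
  proof -
    have "(\<Oplus>\<^bsub>Hom D ?S ?S\<^esub> j \<in> {..<length Xs}. Comp D ?S (?X j) ?S (?i j) (?p j)) =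
        (\<Oplus>\<^bsub>Hom D ?S ?S\<^esub> j \<in> {..<length Xs}. FMap F S S (Comp C S (Xs ! j) S (i j) (p j)))"
      using O X i p by (intro finsum_cong') (auto simp: FMap_Comp FMap_closed FObj_closed cod.Comp_closed)
    also have "\<dots> = FMap F S S (Idt C S)"
      unfolding s[symmetric] using O X i p by (intro FMap_finsum[symmetric]) (auto intro!: dom.Comp_closed)
    finally show ?thesis using O by (simp add: FMap_Idt)
  qed
  \<comment> \<open>The definition indexes the mapped list, and \<open>map (FObj F) Xs ! j\<close>
    can be simplified only for \<open>j\<close> within range, hence under the sum.\<close>
  moreover have "(\<Oplus>\<^bsub>Hom D ?S ?S\<^esub> j \<in> {..<length Xs}. Comp D ?S (map (FObj F) Xs ! j) ?S (?i j) (?p j)) =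
     (\<Oplus>\<^bsub>Hom D ?S ?S\<^esub> j \<in> {..<length Xs}. Comp D ?S (?X j) ?S (?i j) (?p j))"
    using FS X O i p by (intro finsum_cong') (auto intro!: cod.Comp_closed FMap_closed FObj_closed)
  ultimately show ?thesis
    unfolding is_direct_sum_def using O X FS i p
    by (intro conjI exI[of _ ?i] exI[of _ ?p]) (auto simp: FMap_closed FObj_closed)
qed

lemma full_zero_Hom:
  assumes "full_functor C D F" "M \<in> Obj C" "N \<in> Obj C" "zero_Hom C M N"
  shows "zero_Hom D (FObj F M) (FObj F N)"
  using assms FMap_zero[of M N] unfolding full_functor_def zero_Hom_def
  by (metis image_empty image_insert)

text \<open>Each endomorphism of the image lifts along \<open>F\<close>, its lift is a scalar, and
  \<open>F\<close> maps scalars to the same scalars.\<close>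

lemma full_brick:
  assumes full: "full_functor C D F" and M: "brick K C M" and nz: "\<not> zero_object D (FObj F M)"
  shows "brick K D (FObj F M)"
  unfolding brick_def
proof (intro conjI ballI)
  have O: "M \<in> Obj C" using M by (simp add: brick_def)
  show "FObj F M \<in> Obj D" using O by (rule FObj_closed)
  fix g assume "g \<in> carrier (Hom D (FObj F M) (FObj F M))"
  then obtain f where "f \<in> carrier (Hom C M M)" "g = FMap F M M f"
    using full O unfolding full_functor_def by blast
  then show "\<exists>x \<in> carrier K. g = End_scalar D (FObj F M) x"
    using M O FMap_End_scalar[of M] unfolding brick_def by metis
qed (rule nz)

lemma full_reflects_isomorphic_bricks:
  assumes full: "full_functor C D F" and M: "brick K C M" and N: "brick K C N"
    and nz: "\<not> zero_object D (FObj F M)" and iso: "isomorphic D (FObj F M) (FObj F N)"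
  shows "isomorphic C M N"
proof -
  have O: "M \<in> Obj C" "N \<in> Obj C" using M N by (auto simp: brick_def)
  obtain f' g' where f': "f' \<in> carrier (Hom D (FObj F M) (FObj F N))"
    and g': "g' \<in> carrier (Hom D (FObj F N) (FObj F M))"
    and gf: "Comp D (FObj F M) (FObj F N) (FObj F M) g' f' = Idt D (FObj F M)"
    using iso by (auto simp: isomorphic_def inverse_morphisms_def)
  obtain f where f: "f \<in> carrier (Hom C M N)" "f' = FMap F M N f"
    using full O f' unfolding full_functor_def by blast
  obtain g where g: "g \<in> carrier (Hom C N M)" "g' = FMap F N M g"
    using full O g' unfolding full_functor_def by blast
  have "FMap F M M (Comp C M N M g f) = Idt D (FObj F M)"
    using O f g gf by (simp add: FMap_Comp)
  then have "Comp C M N M g f \<noteq> \<zero>\<^bsub>Hom C M M\<^esub>"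
    using O nz by (auto simp: FMap_zero cod.zero_object_iff FObj_closed)
  then show ?thesis using M N f g by (intro dom.bricks_isomorphicI)
qed

lemma faithful_zero_object:
  assumes "faithful_functor C F" "M \<in> Obj C" "zero_object D (FObj F M)"
  shows "zero_object C M"
proof -
  have "FMap F M M (Idt C M) = FMap F M M \<zero>\<^bsub>Hom C M M\<^esub>"
    using assms by (simp add: FMap_Idt FMap_zero cod.zero_object_iff FObj_closed)
  then have "Idt C M = \<zero>\<^bsub>Hom C M M\<^esub>"
    using assms inj_onD[of "FMap F M M" "carrier (Hom C M M)"]
    by (simp add: faithful_functor_def dom.Idt_closed dom.Hom_zero_closed)
  then show ?thesis using assms by (simp add: dom.zero_object_iff)
qed

text \<open>The image of \<open>f\<close> is a scalar and thus also the image of that scalar on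
  \<open>M\<close>; faithfulness identifies the two preimages.\<close>

lemma faithful_reflects_brick:
  assumes faith: "faithful_functor C F" and O: "M \<in> Obj C" and FM: "brick K D (FObj F M)"
  shows "brick K C M"
  unfolding brick_def
proof (intro conjI ballI)
  show "\<not> zero_object C M" using FM FObj_zero_object by (auto simp: brick_def)
  fix f assume f: "f \<in> carrier (Hom C M M)"
  then have "FMap F M M f \<in> carrier (Hom D (FObj F M) (FObj F M))"
    using O by (intro FMap_closed)
  then obtain x where x: "x \<in> carrier K" "FMap F M M f = FMap F M M (End_scalar C M x)"
    using FM O FMap_End_scalar[of M] unfolding brick_def by metis
  have "f = End_scalar C M x"
    using faith O x f inj_onD[of "FMap F M M" "carrier (Hom C M M)"]
    by (simp add: faithful_functor_def dom.End_scalar_closed)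
  then show "\<exists>x \<in> carrier K. f = End_scalar C M x" using x by blast
qed (rule O)

end

section \<open>Consequences of natural isomorphisms\<close>

lemma naturally_isomorphic_isomorphic:
  assumes "naturally_isomorphic C D F G" and "M \<in> Obj C" "FObj F M \<in> Obj D" "FObj G M \<in> Obj D"
  shows "isomorphic D (FObj F M) (FObj G M)"
  using assms unfolding naturally_isomorphic_def isomorphic_def by blast

text \<open>Naturality expresses \<open>f\<close> composed with the invertible
  \<open>\<eta> M\<close> through \<open>G (F f)\<close>, so \<open>F f\<close> determines
  \<open>f\<close>.\<close>

lemma faithful_functorI:
  assumes "linear_functor K C D F" and "linear_functor K D C G"
    and nat: "naturally_isomorphic C C (comp_functor G F) id_functor"
  shows "faithful_functor C F"
  unfolding faithful_functor_def
proof (intro ballI inj_onI)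
  interpret F: linear_functor K C D F by fact
  interpret G: linear_functor K D C G by fact
  fix M N f f' assume O: "M \<in> Obj C" "N \<in> Obj C"
    and f: "f \<in> carrier (Hom C M N)" and f': "f' \<in> carrier (Hom C M N)"
    and eq: "FMap F M N f = FMap F M N f'"
  let ?GF = "\<lambda>M. FObj G (FObj F M)"
  obtain \<eta> where \<eta>: "\<forall>M \<in> Obj C. \<exists>g. inverse_morphisms C (?GF M) M (\<eta> M) g"
    and N: "\<forall>M \<in> Obj C. \<forall>N \<in> Obj C. \<forall>f \<in> carrier (Hom C M N).
        Comp C (?GF M) (?GF N) N (\<eta> N) (FMap G (FObj F M) (FObj F N) (FMap F M N f)) =
        Comp C (?GF M) M N f (\<eta> M)"
    using nat unfolding naturally_isomorphic_def comp_functor_def id_functor_def by auto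
  obtain g where g: "g \<in> carrier (Hom C M (?GF M))" "\<eta> M \<in> carrier (Hom C (?GF M) M)"
    and \<eta>g: "Comp C M (?GF M) M (\<eta> M) g = Idt C M"
    using \<eta> O(1) by (auto simp: inverse_morphisms_def)
  have GF: "?GF M \<in> Obj C" using O F.FObj_closed G.FObj_closed by blast
  \<comment> \<open>Cancels \<open>\<eta> M\<close> on the right by means of its inverse
    \<open>g\<close>.\<close>
  have *: "u = Comp C M (?GF M) N (Comp C (?GF M) M N u (\<eta> M)) g" if "u \<in> carrier (Hom C M N)" for u
    using F.dom.Comp_assoc[of M "?GF M" M N g "\<eta> M" u] O GF g \<eta>g that by (simp add: F.dom.Idt_right)
  have "Comp C (?GF M) M N f (\<eta> M) = Comp C (?GF M) M N f' (\<eta> M)"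
    using N[rule_format, OF O f] N[rule_format, OF O f'] eq by simp
  then show "f = f'" using *[OF f] *[OF f'] by simp
qed


section \<open>The split Grothendieck group\<close>

lemma K0_relations_zero: "0 \<in> K0_relations C"
  using generate.one[of "free_Abelian_group (Obj C)"] by (simp add: K0_relations_def)

lemma K0_relations_add: "x \<in> K0_relations C \<Longrightarrow> y \<in> K0_relations C \<Longrightarrow> x + y \<in> K0_relations C"
  unfolding K0_relations_def using generate.eng[of x "free_Abelian_group (Obj C)" _ y] by simp

lemma K0_relations_direct_sum:
  "is_direct_sum C [A, B] S \<Longrightarrow> frag_of S - frag_of A - frag_of B \<in> K0_relations C"
  unfolding K0_relations_def by (intro generate.incl) blast

text \<open>Replaces the inverse of the free abelian group by unary minus. The two agree on elements
  supported on objects, so the case \<open>inv\<close> has to check the support of the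
  generator.\<close>

lemma K0_relations_induct [consumes 1, case_names zero direct_sum minus add]:
  assumes "x \<in> K0_relations C"
    and "P 0"
    and ds: "\<And>S A B. is_direct_sum C [A, B] S \<Longrightarrow> P (frag_of S - frag_of A - frag_of B)"
    and minus: "\<And>S A B. is_direct_sum C [A, B] S \<Longrightarrow> P (- (frag_of S - frag_of A - frag_of B))"
    and add: "\<And>x y. P x \<Longrightarrow> P y \<Longrightarrow> P (x + y)"
  shows "P x"
  using assms(1) unfolding K0_relations_def
proof (induction rule: generate.induct)
  case (inv h)
  then obtain S A B where h: "h = frag_of S - frag_of A - frag_of B" "is_direct_sum C [A, B] S" by auto
  then have "set [A, B] \<subseteq> Obj C" "S \<in> Obj C" unfolding is_direct_sum_def by blast+
  then have "Poly_Mapping.keys h \<subseteq> Obj C"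
    using keys_diff[of "frag_of S - frag_of A" "frag_of B"] keys_diff[of "frag_of S" "frag_of A"]
    unfolding h(1) by (auto split: if_splits)
  then show ?case using minus[OF h(2)] h(1) by simp
qed (use assms(2) ds add in auto)

text \<open>Induction is required because \<open>generate\<close> adjoins inverses of generators
  only, while negation of a sum is distributed over its terms.\<close>

lemma K0_relations_minus: "x \<in> K0_relations C \<Longrightarrow> - x \<in> K0_relations C"
proof (induction rule: K0_relations_induct)
  case (minus S A B)
  then show ?case using K0_relations_direct_sum[of C A B S] by simp
next
  case (direct_sum S A B)
  then show ?case
  proof -
    have set: "set [A, B] \<subseteq> Obj C" "S \<in> Obj C"
      using direct_sum unfolding is_direct_sum_def by blast+
    let ?h = "frag_of S - frag_of A - frag_of B"
    have "Poly_Mapping.keys ?h \<subseteq> Obj C"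
      using set keys_diff[of "frag_of S - frag_of A" "frag_of B"] keys_diff[of "frag_of S" "frag_of A"]
      by (auto split: if_splits)
    moreover have "inv\<^bsub>free_Abelian_group (Obj C)\<^esub> ?h \<in> K0_relations C"
      unfolding K0_relations_def using direct_sum by (intro generate.inv) blast
    ultimately show ?thesis by simp
  qed
next
  case (add x y)
  then show ?case using K0_relations_add[of "- x" C "- y"] by simp
qed (simp add: K0_relations_zero)

lemma K0_coset_eq: "K0_coset C x = (\<lambda>r. r + x) ` K0_relations C"
  by (auto simp: K0_coset_def r_coset_def)

text \<open>A coset is a translate of a set closed under addition and negation. Hence
  \<open>x\<close> and \<open>y\<close> may be arbitrary formal sums, with no condition on their
  supports.\<close>

lemma K0_coset_eq_iff: "K0_coset C x = K0_coset C y \<longleftrightarrow> x - y \<in> K0_relations C"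
proof
  assume "K0_coset C x = K0_coset C y"
  moreover have "x \<in> K0_coset C x"
    unfolding K0_coset_eq by (rule image_eqI[OF _ K0_relations_zero]) simp
  ultimately show "x - y \<in> K0_relations C" by (auto simp: K0_coset_eq)
next
  assume d: "x - y \<in> K0_relations C"
  have "r + x \<in> K0_coset C y" if "r \<in> K0_relations C" for r
    unfolding K0_coset_eq using K0_relations_add[OF that d] by (intro image_eqI[of _ _ "r + (x - y)"]) auto
  moreover have "r + y \<in> K0_coset C x" if "r \<in> K0_relations C" for r
    unfolding K0_coset_eq using K0_relations_add[OF that K0_relations_minus[OF d]]
    by (intro image_eqI[of _ _ "r + - (x - y)"]) auto
  ultimately show "K0_coset C x = K0_coset C y" unfolding K0_coset_eq by blast
qed

lemma K0_class_eq_iff: "K0_class C M = K0_class C N \<longleftrightarrow> frag_of M - frag_of N \<in> K0_relations C"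
  by (simp add: K0_class_def K0_coset_eq_iff)

lemma zero_K0: "\<zero>\<^bsub>K0 C\<^esub> = K0_coset C 0"
  by (simp add: K0_def FactGroup_def K0_coset_eq)

text \<open>This also shows that the choice hidden in \<open>the_elem\<close> is harmless in \<open>K0_map\<close>.\<close>

lemma (in linear_functor) K0_map_K0_class: "K0_map D F (K0_class C M) = K0_class D (FObj F M)"
proof -
  let ?F = "frag_extend (\<lambda>M. frag_of (FObj F M))"
  have rel: "?F r \<in> K0_relations D" if "r \<in> K0_relations C" for r
    using that
  proof (induction rule: K0_relations_induct)
    case (direct_sum S A B)
    then show ?case
      using FObj_is_direct_sum[OF direct_sum] K0_relations_direct_sum[of D "FObj F A" "FObj F B" "FObj F S"]
      by (simp add: frag_extend_diff)
  next
    case (minus S A B)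
    then show ?case
      using FObj_is_direct_sum[OF minus]
        K0_relations_minus[OF K0_relations_direct_sum[of D "FObj F A" "FObj F B" "FObj F S"]]
      by (simp add: frag_extend_diff frag_extend_minus)
  qed (auto simp: K0_relations_zero frag_extend_add K0_relations_add)
  have "K0_coset D (?F x) = K0_class D (FObj F M)" if "x \<in> K0_class C M" for x
  proof -
    from that obtain r where "r \<in> K0_relations C" "x = r + frag_of M"
      by (auto simp: K0_class_def K0_coset_eq)
    then show ?thesis
      using rel by (simp add: K0_class_def K0_coset_eq_iff frag_extend_add)
  qed
  \<comment> \<open>Without a representative, the image under which \<open>the_elem\<close> is taken
    would be empty instead of a singleton.\<close>
  moreover have "K0_class C M \<noteq> {}"
    using K0_relations_zero by (auto simp: K0_class_def K0_coset_eq)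
  ultimately have "(\<lambda>x. K0_coset D (?F x)) ` K0_class C M = {K0_class D (FObj F M)}" by auto
  then show ?thesis by (simp add: K0_map_def)
qed

context linear_category
begin

text \<open>A zero object is the direct sum of two copies of itself, so
  \<open>[Z] = [Z] + [Z]\<close>.\<close>

lemma zero_object_K0_class:
  assumes "zero_object C Z"
  shows "K0_class C Z = K0_coset C 0"
proof -
  have "is_direct_sum C [Z, Z] Z"
    using assms by (intro is_direct_sum_zero_right isomorphic_refl) (auto simp: zero_object_def)
  then have "frag_of Z - frag_of Z - frag_of Z \<in> K0_relations C" by (rule K0_relations_direct_sum)
  then show ?thesis using K0_relations_minus[of "- frag_of Z" C]
    by (simp add: K0_class_def K0_coset_eq_iff)
qed

text \<open>\<open>M\<close> is a direct sum of \<open>N\<close> and a zero object, and the latter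
  has class zero.\<close>

lemma isomorphic_K0_class:
  assumes "additive_category C" and "isomorphic C M N"
  shows "K0_class C M = K0_class C N"
proof -
  obtain Z where Z: "zero_object C Z" using assms(1) by (auto simp: additive_category_def)
  have "is_direct_sum C [N, Z] M"
    using is_direct_sum_zero_right[OF isomorphic_sym[OF assms(2)] Z] .
  then have "frag_of M - frag_of N - frag_of Z \<in> K0_relations C" by (rule K0_relations_direct_sum)
  moreover have "frag_of Z \<in> K0_relations C"
    using zero_object_K0_class[OF Z] by (simp add: K0_class_def K0_coset_eq_iff)
  ultimately have "frag_of M - frag_of N - frag_of Z + frag_of Z \<in> K0_relations C"
    by (rule K0_relations_add)
  then show ?thesis by (simp add: K0_class_eq_iff)
qed

text \<open>Rank-nullity for composition with \<open>pA\<close>: it maps onto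
  \<open>Hom C X A\<close> because \<open>pA iA = id\<close>, and its kernel is a copy of
  \<open>Hom C X B\<close>, embedded by \<open>iB\<close>.\<close>

lemma dim_Hom_direct_sum:
  assumes "is_direct_sum C [A, B] S" and X: "X \<in> Obj C"
    and fd: "vectorspace.fin_dim K (Hom C X S)" "vectorspace.fin_dim K (Hom C X B)"
  shows "vectorspace.dim K (Hom C X S) = vectorspace.dim K (Hom C X A) + vectorspace.dim K (Hom C X B)"
  using assms(1)
proof (rule is_direct_sum_pairE)
  fix iA iB pA pB
  assume O: "A \<in> Obj C" "B \<in> Obj C" "S \<in> Obj C"
    and cl: "iA \<in> carrier (Hom C A S)" "iB \<in> carrier (Hom C B S)"
      "pA \<in> carrier (Hom C S A)" "pB \<in> carrier (Hom C S B)"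
    and id: "Comp C A S A pA iA = Idt C A" "Comp C B S B pB iB = Idt C B"
    and 0: "Comp C B S A pA iB = \<zero>\<^bsub>Hom C B A\<^esub>"
    and s: "Comp C S A S iA pA \<oplus>\<^bsub>Hom C S S\<^esub> Comp C S B S iB pB = Idt C S"
  interpret p: linear_map K "Hom C X S" "Hom C X A" "Comp C X S A pA"
    using Comp_linear_right[of X S A pA] O X cl by simp
  interpret i: linear_map K "Hom C X B" "Hom C X S" "Comp C X B S iB"
    using Comp_linear_right[of X B S iB] O X cl by simp
  have "inj_on (Comp C X B S iB) (carrier (Hom C X B))"
  proof (rule inj_on_inverseI)
    fix f assume f: "f \<in> carrier (Hom C X B)"
    have "Comp C X S B pB (Comp C X B S iB f) = Comp C X B B (Comp C B S B pB iB) f"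
      using O X cl f by (intro Comp_assoc)
    then show "Comp C X S B pB (Comp C X B S iB f) = f" using O X f id by (simp add: Idt_left)
  qed
  then have "vectorspace.dim K (Hom C X B \<lparr>carrier := i.kerT\<rparr>) = 0" by (rule i.inj_imp_dim_ker0)
  then have B: "vectorspace.dim K (Hom C X S \<lparr>carrier := i.imT\<rparr>) = vectorspace.dim K (Hom C X B)"
    using i.rank_nullity[OF fd(2)] by simp
  have "p.imT = carrier (Hom C X A)"
    unfolding p.im_def
  proof (intro equalityI subsetI)
    fix f assume f: "f \<in> carrier (Hom C X A)"
    have "Comp C X S A pA (Comp C X A S iA f) = Comp C X A A (Comp C A S A pA iA) f"
      using O X cl f by (intro Comp_assoc)
    then have "f = Comp C X S A pA (Comp C X A S iA f)" using O X f id by (simp add: Idt_left)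
    then show "f \<in> Comp C X S A pA ` carrier (Hom C X S)"
      using O X cl f by (metis Comp_closed imageI)
  qed (use O X cl in \<open>auto simp: Comp_closed\<close>)
  \<comment> \<open>Writing \<open>f = iA (pA f) + iB (pB f)\<close>, the condition
    \<open>pA f = 0\<close> leaves the second term; conversely \<open>pA iB = 0\<close>.\<close>
  moreover have "p.kerT = i.imT"
    unfolding p.ker_def i.im_def
  proof (intro equalityI subsetI)
    fix f assume "f \<in> {f \<in> carrier (Hom C X S). Comp C X S A pA f = \<zero>\<^bsub>Hom C X A\<^esub>}"
    then have f: "f \<in> carrier (Hom C X S)" "Comp C X S A pA f = \<zero>\<^bsub>Hom C X A\<^esub>" by auto
    have "f = Comp C X S S (Idt C S) f" using O X f by (simp add: Idt_left)
    also have "\<dots> = Comp C X S S (Comp C S A S iA pA) f \<oplus>\<^bsub>Hom C X S\<^esub> Comp C X S S (Comp C S B S iB pB) f"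
      unfolding s[symmetric] using O X cl f by (intro Comp_add_left Comp_closed)
    also have "Comp C X S S (Comp C S A S iA pA) f = Comp C X A S iA (Comp C X S A pA f)"
      using O X cl f by (intro Comp_assoc[symmetric])
    also have "Comp C X S S (Comp C S B S iB pB) f = Comp C X B S iB (Comp C X S B pB f)"
      using O X cl f by (intro Comp_assoc[symmetric])
    finally have "f = Comp C X B S iB (Comp C X S B pB f)"
      using O X cl f by (simp add: Comp_zero_right Hom_l_zero Comp_closed)
    then show "f \<in> Comp C X B S iB ` carrier (Hom C X B)"
      using O X cl f by (metis Comp_closed imageI)
  next
    fix f assume "f \<in> Comp C X B S iB ` carrier (Hom C X B)"
    then obtain g where g: "g \<in> carrier (Hom C X B)" "f = Comp C X B S iB g" by blast
    have "Comp C X S A pA f = Comp C X B A (Comp C B S A pA iB) g"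
      unfolding g(2) using O X cl g by (intro Comp_assoc)
    then show "f \<in> {f \<in> carrier (Hom C X S). Comp C X S A pA f = \<zero>\<^bsub>Hom C X A\<^esub>}"
      using O X cl g 0 by (simp add: Comp_closed Comp_zero_left)
  qed
  ultimately show ?thesis using p.rank_nullity[OF fd(1)] B by simp
qed

end


section \<open>Mixed humorous categories\<close>

context humorous_category
begin

lemma K0_relations_dim_Hom:
  assumes X: "X \<in> Obj C" and "r \<in> K0_relations C"
  shows "frag_extend (\<lambda>M. frag_cmul (int (vectorspace.dim K (Hom C X M))) (frag_of ())) r = 0"
  using assms(2)
proof (induction rule: K0_relations_induct)
  case (direct_sum S A B)
  then have "vectorspace.dim K (Hom C X S) = vectorspace.dim K (Hom C X A) + vectorspace.dim K (Hom C X B)"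
    using X Hom_fin_dim by (intro dim_Hom_direct_sum) (auto simp: is_direct_sum_def)
  then show ?case by (simp add: frag_extend_diff frag_cmul_distrib)
next
  case (minus S A B)
  then have "vectorspace.dim K (Hom C X S) = vectorspace.dim K (Hom C X A) + vectorspace.dim K (Hom C X B)"
    using X Hom_fin_dim by (intro dim_Hom_direct_sum) (auto simp: is_direct_sum_def)
  then show ?case by (simp add: frag_extend_diff frag_extend_minus frag_cmul_distrib)
qed (auto simp: frag_extend_add)

lemma K0_class_eq_dim_Hom:
  assumes X: "X \<in> Obj C" and "K0_class C M = K0_class C N"
  shows "vectorspace.dim K (Hom C X M) = vectorspace.dim K (Hom C X N)"
proof -
  have "frag_of M - frag_of N \<in> K0_relations C" using assms(2) by (simp add: K0_class_eq_iff)
  from K0_relations_dim_Hom[OF X this]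
  have "frag_cmul (int (vectorspace.dim K (Hom C X M)) - int (vectorspace.dim K (Hom C X N))) (frag_of ()) = 0"
    by (simp add: frag_extend_diff frag_cmul_diff_distrib)
  then show ?thesis by simp
qed

text \<open>Finite dimensionality supplies a finite basis for \<open>dim\<close> to count; if it is
  empty, its span is zero.\<close>

lemma dim_Hom_eq_0:
  assumes O: "M \<in> Obj C" "N \<in> Obj C"
  shows "vectorspace.dim K (Hom C M N) = 0 \<longleftrightarrow> zero_Hom C M N"
proof -
  interpret vectorspace K "Hom C M N" using O by (rule vectorspace_Hom)
  obtain B where B: "finite B" "basis B" using finite_basis_exists Hom_fin_dim[OF O] by blast
  then have "dim = card B" by (rule dim_basis)
  show ?thesis
  proof
    assume "dim = 0"
    then have "B = {}" using B \<open>dim = card B\<close> by simp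
    then have "carrier (Hom C M N) = {\<zero>\<^bsub>Hom C M N\<^esub>}" using B by (simp add: basis_def span_empty)
    then show "zero_Hom C M N" by (simp add: zero_Hom_def)
  next
    assume "zero_Hom C M N"
    moreover have "\<zero>\<^bsub>Hom C M N\<^esub> \<in> span {\<zero>\<^bsub>Hom C M N\<^esub>}"
      by (rule span_zero)
    moreover have "span {\<zero>\<^bsub>Hom C M N\<^esub>} \<subseteq> carrier (Hom C M N)"
      using span_closed[of "{\<zero>\<^bsub>Hom C M N\<^esub>}"] by blast
    ultimately have "span {\<zero>\<^bsub>Hom C M N\<^esub>} = carrier (Hom C M N)"
      unfolding zero_Hom_def by (metis empty_subsetI insert_subset subset_antisym)
    then show "dim = 0" by (intro dim0I) simp
  qed
qed

section \<open>Shift, duality and the orthodox basis\<close>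

lemma shift_one: "shift C 1 M = FObj (Shift C) M"
  by (simp add: shift_def)

text \<open>The brick \<open>M\<close> is isomorphic to the unshift of its shift. By
  \<open>Shift_Unshift\<close> the unshift is faithful, so it reflects bricks.\<close>

lemma Shift_brick:
  assumes M: "brick K C M"
  shows "brick K C (FObj (Shift C) M)"
proof -
  interpret S: linear_functor K C C "Shift C" by (rule Shift_functor)
  interpret U: linear_functor K C C "Unshift C" by (rule Unshift_functor)
  have O: "M \<in> Obj C" using M by (simp add: brick_def)
  then have "isomorphic C (FObj (Unshift C) (FObj (Shift C) M)) M"
    using naturally_isomorphic_isomorphic[OF Unshift_Shift O] U.FObj_closed S.FObj_closed
    by (simp add: comp_functor_def id_functor_def)
  then have "brick K C (FObj (Unshift C) (FObj (Shift C) M))"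
    using M brick_isomorphic isomorphic_sym by blast
  moreover have "faithful_functor C (Unshift C)"
    using Unshift_functor Shift_functor Shift_Unshift by (rule faithful_functorI)
  ultimately show ?thesis using O S.FObj_closed U.faithful_reflects_brick by blast
qed

text \<open>Fullness of the duality makes endomorphisms of the dual scalar, and faithfulness keeps
  the dual nonzero.\<close>

lemma Dual_brick:
  assumes M: "brick K C M"
  shows "brick K C (dual C M)"
proof -
  interpret D: linear_functor K "op_cat C" C "Dual C" by (rule Dual_functor)
  have M': "brick K (op_cat C) M" using M by (simp add: brick_op_cat)
  show ?thesis
    using D.full_brick[OF Dual_full M'] D.faithful_zero_object[OF Dual_faithful] M'
    by (auto simp: brick_def)
qed

lemma Dual_isomorphic: "isomorphic C M N \<Longrightarrow> isomorphic C (dual C M) (dual C N)"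
  using linear_functor.FObj_isomorphic[OF Dual_functor] by (simp add: isomorphic_op_cat)

text \<open>Removes the choice in \<open>orthodox_object\<close>: fixed points in one orbit are
  isomorphic, so every self-dual indecomposable has the class of the chosen one.\<close>

lemma orthodox_basis_eq:
  "orthodox_basis C = {K0_class C P |P. indecomposable C P \<and> isomorphic C (dual C P) P}"
proof (intro equalityI subsetI)
  fix b assume "b \<in> orthodox_basis C"
  then obtain c where c: "c \<in> orbits C" "b = K0_class C (orthodox_object C c)"
    by (auto simp: orthodox_basis_def)
  have P: "orthodox_object C c \<in> c" "isomorphic C (dual C (orthodox_object C c)) (orthodox_object C c)"
    using someI_ex[of "\<lambda>P. P \<in> c \<and> isomorphic C (dual C P) P"] fixed_point_exists[OF c(1)]
    unfolding orthodox_object_def by blast+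
  moreover have "indecomposable C (orthodox_object C c)"
    using P(1) c(1) by (auto simp: orbits_def orbit_rel_def elim!: quotientE)
  ultimately show "b \<in> {K0_class C P |P. indecomposable C P \<and> isomorphic C (dual C P) P}"
    using c by blast
next
  fix b assume "b \<in> {K0_class C P |P. indecomposable C P \<and> isomorphic C (dual C P) P}"
  then obtain P where P: "b = K0_class C P" "indecomposable C P" "isomorphic C (dual C P) P" by auto
  let ?c = "orbit_rel C `` {P}"
  have c: "?c \<in> orbits C" using P by (auto simp: orbits_def intro: quotientI)
  \<comment> \<open>The zero shift places \<open>P\<close> in its own orbit.\<close>
  have "shift C 0 P = P" by (simp add: shift_def)
  then have Pc: "P \<in> ?c"
    using P isomorphic_refl[of P] unfolding orbit_rel_def indecomposable_def
    by (auto intro!: exI[of _ 0])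
  then have "orthodox_object C ?c \<in> ?c \<and> isomorphic C (dual C (orthodox_object C ?c)) (orthodox_object C ?c)"
    using someI_ex[of "\<lambda>P. P \<in> ?c \<and> isomorphic C (dual C P) P"] P unfolding orthodox_object_def by blast
  then have "isomorphic C (orthodox_object C ?c) P"
    using fixed_point_unique[OF c _ Pc _ P(3)] by blast
  then have "K0_class C (orthodox_object C ?c) = b"
    using P isomorphic_K0_class[OF additive] by simp
  then show "b \<in> orthodox_basis C" using c by (auto simp: orthodox_basis_def)
qed

lemma finite_orthodox_basis: "finite (orthodox_basis C)"
  using finite_orbits by (simp add: orthodox_basis_def)

text \<open>The dimension of morphisms from \<open>M\<close> is an invariant of the class; it is
  positive at \<open>M\<close> and zero at a zero object.\<close>

lemma indecomposable_K0_class_nonzero: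
  assumes M: "indecomposable C M"
  shows "K0_class C M \<noteq> \<zero>\<^bsub>K0 C\<^esub>"
proof
  obtain Z where Z: "zero_object C Z" using additive by (auto simp: additive_category_def)
  have O: "M \<in> Obj C" using M by (simp add: indecomposable_def)
  assume "K0_class C M = \<zero>\<^bsub>K0 C\<^esub>"
  then have "K0_class C M = K0_class C Z" using zero_object_K0_class[OF Z] by (simp add: zero_K0)
  then have "vectorspace.dim K (Hom C M M) = vectorspace.dim K (Hom C M Z)"
    using O by (rule K0_class_eq_dim_Hom[rotated])
  moreover have "zero_Hom C M Z" using Z O by (simp add: zero_object_def)
  moreover have "Z \<in> Obj C" using Z by (simp add: zero_object_def)
  ultimately have "zero_Hom C M M" using O dim_Hom_eq_0 by metis
  then show False using M O by (simp add: indecomposable_def zero_object_iff_zero_Hom)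
qed

lemma mixed_indecomposable_iff_brick:
  assumes "mixed K C"
  shows "indecomposable C M \<longleftrightarrow> brick K C M"
proof
  assume M: "indecomposable C M"
  then have "End_scalar C M \<in> ring_iso K (End_ring C M)"
    using assms by (auto simp: mixed_def)
  then show "brick K C M"
    using M brick_iff_End_scalar_iso by (auto simp: indecomposable_def)
qed (rule brick_indecomposable)

lemma mixed_K0_class_inj:
  assumes "mixed K C" and M: "indecomposable C M" and N: "indecomposable C N"
    and eq: "K0_class C M = K0_class C N"
  shows "isomorphic C M N"
proof (rule ccontr)
  assume n: "\<not> isomorphic C M N"
  have O: "M \<in> Obj C" "N \<in> Obj C" using M N by (auto simp: indecomposable_def)
  have "\<not> zero_Hom C M M" "\<not> zero_Hom C N N"
    using M N O by (auto simp: indecomposable_def zero_object_iff_zero_Hom)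
  \<comment> \<open>Testing the equal classes with \<open>X = M\<close> and with
    \<open>X = N\<close> transfers nonvanishing from the two endomorphism spaces. Whichever way the
    weights compare, one of these mixed spaces would have to vanish.\<close>
  then have nz: "\<not> zero_Hom C M N" "\<not> zero_Hom C N M"
    using K0_class_eq_dim_Hom[OF O(1) eq] K0_class_eq_dim_Hom[OF O(2) eq] O dim_Hom_eq_0
    by metis+
  from assms(1) obtain wt :: "_ \<Rightarrow> int" where
    "\<And>M N. indecomposable C M \<Longrightarrow> indecomposable C N \<Longrightarrow>
        wt N < wt M \<or> \<not> isomorphic C M N \<and> wt N = wt M \<Longrightarrow> zero_Hom C M N"
    unfolding mixed_def by blast
  with M N n nz show False by (metis linorder_less_linear)
qed

end


section \<open>Full and essentially surjective functors\<close>

locale humorous_quotient =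
  C: humorous_category K C + D: humorous_category K D + linear_functor K C D F
  for K :: "'k ring" and C :: "('o, 'm, 'k, 'y) graded_data_scheme"
    and D :: "('p, 'n, 'k, 'z) graded_data_scheme" and F :: "('o, 'm, 'p, 'n) functor_data" +
  assumes full: "full_functor C D F"
    and dense: "essentially_surjective C D F"
    and F_Shift: "naturally_isomorphic C D (comp_functor F (Shift C)) (comp_functor (Shift D) F)"
    and F_Dual: "naturally_isomorphic (op_cat C) D
      (comp_functor F (Dual C)) (comp_functor (Dual D) (op_functor F))"
    and mixed_dom: "mixed K C"
begin

lemma FObj_Shift:
  assumes M: "M \<in> Obj C"
  shows "isomorphic D (FObj F (FObj (Shift C) M)) (FObj (Shift D) (FObj F M))"
proof -
  have "FObj (Shift C) M \<in> Obj C" "FObj (Shift D) (FObj F M) \<in> Obj D"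
    using M FObj_closed linear_functor.FObj_closed[OF C.Shift_functor]
      linear_functor.FObj_closed[OF D.Shift_functor] by blast+
  then show ?thesis
    using naturally_isomorphic_isomorphic[OF F_Shift M] FObj_closed by (simp add: comp_functor_def)
qed

lemma FObj_Dual:
  assumes M: "M \<in> Obj C"
  shows "isomorphic D (FObj F (dual C M)) (dual D (FObj F M))"
proof -
  have "dual C M \<in> Obj C" "dual D (FObj F M) \<in> Obj D"
    using M FObj_closed linear_functor.FObj_closed[OF C.Dual_functor]
      linear_functor.FObj_closed[OF D.Dual_functor] by auto
  then show ?thesis
    using naturally_isomorphic_isomorphic[OF F_Dual] M FObj_closed
    by (simp add: comp_functor_def op_functor_def)
qed

text \<open>An arbitrary preimage \<open>X\<close> is decomposed before \<open>F\<close> is applied.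
  Its summands have local endomorphism rings and so are bricks, and the image of one of them is
  already all of \<open>N\<close>.\<close>

lemma indecomposable_lift:
  assumes N: "indecomposable D N"
  obtains M where "brick K C M" "isomorphic D (FObj F M) N"
proof -
  have "N \<in> Obj D" using N by (simp add: indecomposable_def)
  then obtain X where X: "X \<in> Obj C" "isomorphic D (FObj F X) N"
    using dense by (auto simp: essentially_surjective_def)
  obtain Xs where Xs: "is_direct_sum C Xs X" "\<forall>M \<in> set Xs. is_local_ring (End_ring C M)"
    using C.krull_schmidt X by (auto simp: krull_schmidt_def)
  have "is_direct_sum D (map (FObj F) Xs) N"
    using FObj_is_direct_sum[OF Xs(1)] X(2) by (rule D.is_direct_sum_isomorphic)
  from D.indecomposable_isomorphic_summand[OF D.additive N this]
  obtain M where M: "M \<in> set Xs" "isomorphic D (FObj F M) N" by auto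
  moreover have "M \<in> Obj C" using M Xs by (auto simp: is_direct_sum_def)
  ultimately have "brick K C M"
    using Xs C.local_End_ring_indecomposable C.mixed_indecomposable_iff_brick[OF mixed_dom] by blast
  then show thesis using M that by blast
qed

lemma indecomposable_nonzero_image:
  "indecomposable D N \<Longrightarrow> isomorphic D (FObj F M) N \<Longrightarrow> \<not> zero_object D (FObj F M)"
  using D.zero_object_isomorphic by (auto simp: indecomposable_def)

text \<open>Obtained from a lift, as mixedness of the target is still to be proved and this
  equivalence enters its proof.\<close>

lemma cod_indecomposable_iff_brick: "indecomposable D N \<longleftrightarrow> brick K D N"
proof
  assume N: "indecomposable D N"
  then obtain M where M: "brick K C M" "isomorphic D (FObj F M) N" by (rule indecomposable_lift)
  with N have "brick K D (FObj F M)" using full full_brick indecomposable_nonzero_image by blast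
  then show "brick K D N" using M D.brick_isomorphic by blast
qed (rule D.brick_indecomposable)

text \<open>Uniqueness of lifts up to isomorphism: a common indecomposable image is nonzero, so the
  isomorphism of images is reflected.\<close>

lemma bricks_isomorphic_if_image:
  assumes "brick K C M" "brick K C M'" "indecomposable D N"
    and "isomorphic D (FObj F M) N" "isomorphic D (FObj F M') N"
  shows "isomorphic C M M'"
  using assms full indecomposable_nonzero_image full_reflects_isomorphic_bricks
    D.isomorphic_sym D.isomorphic_trans by blast

lemma mixed_cod: "mixed K D"
proof -
  from mixed_dom obtain wt :: "'o \<Rightarrow> int" where
    wt: "\<And>M. indecomposable C M \<Longrightarrow>
        wt (shift C 1 M) = wt M + 1 \<and> wt (dual C M) = - wt M"
    and zero: "\<And>M N. indecomposable C M \<Longrightarrow> indecomposable C N \<Longrightarrow>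
        wt N < wt M \<or> \<not> isomorphic C M N \<and> wt N = wt M \<Longrightarrow> zero_Hom C M N"
    unfolding mixed_def by blast
  \<comment> \<open>Isomorphic bricks have nonzero morphisms in both directions, and unequal weights
    would kill one direction.\<close>
  have wt_iso: "wt M = wt N" if M: "brick K C M" and N: "brick K C N" and iso: "isomorphic C M N" for M N
  proof -
    have O: "M \<in> Obj C" "N \<in> Obj C" and "\<not> zero_object C M" "\<not> zero_object C N"
      using M N by (auto simp: brick_def)
    then have "\<not> zero_Hom C M N" "\<not> zero_Hom C N M"
      using C.zero_Hom_isomorphic[OF C.isomorphic_refl C.isomorphic_sym[OF iso], of M]
        C.zero_Hom_isomorphic[OF C.isomorphic_refl iso, of N] by (auto simp: C.zero_object_iff_zero_Hom)
    then show ?thesis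
      using zero[of M N] zero[of N M] M N C.brick_indecomposable by (metis linorder_less_linear)
  qed
  define lift where "lift N = (SOME M. brick K C M \<and> isomorphic D (FObj F M) N)" for N
  have lift: "brick K C (lift N)" "isomorphic D (FObj F (lift N)) N" if "indecomposable D N" for N
    using someI_ex[of "\<lambda>M. brick K C M \<and> isomorphic D (FObj F M) N"] indecomposable_lift[OF that]
    unfolding lift_def by blast+
  define wt' where "wt' N = wt (lift N)" for N
  \<comment> \<open>Independence of the chosen lift: any brick lying over \<open>N\<close> computes
    the new weight, so shifts and duals of lifts may be used below.\<close>
  have wt': "wt' N = wt M" if "brick K C M" "indecomposable D N" "isomorphic D (FObj F M) N" for M N
    unfolding wt'_def using that lift bricks_isomorphic_if_image wt_iso by blast
  have "wt' (shift D 1 N) = wt' N + 1 \<and> wt' (dual D N) = - wt' N \<and>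
      End_scalar D N \<in> ring_iso K (End_ring D N)" if N: "indecomposable D N" for N
  proof (intro conjI)
    let ?M = "lift N"
    have M: "brick K C ?M" "isomorphic D (FObj F ?M) N" using N lift by auto
    then have O: "?M \<in> Obj C" by (simp add: brick_def)
    have bN: "brick K D N" using N cod_indecomposable_iff_brick by blast
    have "isomorphic D (FObj F (FObj (Shift C) ?M)) (FObj (Shift D) N)"
      using FObj_Shift[OF O] linear_functor.FObj_isomorphic[OF D.Shift_functor M(2)]
      by (rule D.isomorphic_trans)
    moreover have "indecomposable D (FObj (Shift D) N)"
      using bN D.Shift_brick D.brick_indecomposable by blast
    ultimately have "wt' (shift D 1 N) = wt (shift C 1 ?M)"
      using M C.Shift_brick wt' by (simp add: C.shift_one D.shift_one)
    then show "wt' (shift D 1 N) = wt' N + 1"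
      using wt[OF C.brick_indecomposable[OF M(1)]] by (simp add: wt'_def)
    have "isomorphic D (FObj F (dual C ?M)) (dual D N)"
      using FObj_Dual[OF O] D.Dual_isomorphic[OF M(2)] by (rule D.isomorphic_trans)
    moreover have "indecomposable D (dual D N)"
      using bN D.Dual_brick D.brick_indecomposable by blast
    ultimately have "wt' (dual D N) = wt (dual C ?M)"
      using M C.Dual_brick wt' by simp
    then show "wt' (dual D N) = - wt' N"
      using wt[OF C.brick_indecomposable[OF M(1)]] by (simp add: wt'_def)
    show "End_scalar D N \<in> ring_iso K (End_ring D N)"
      using bN D.brick_iff_End_scalar_iso by (auto simp: brick_def)
  qed
  moreover have "zero_Hom D N N'"
    if N: "indecomposable D N" "indecomposable D N'"
      and w: "wt' N' < wt' N \<or> \<not> isomorphic D N N' \<and> wt' N' = wt' N" for N N'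
  proof -
    have M: "brick K C (lift N)" "isomorphic D (FObj F (lift N)) N"
      "brick K C (lift N')" "isomorphic D (FObj F (lift N')) N'" using N lift by auto
    \<comment> \<open>An isomorphism of lifts would pass to their images. Hence the equal-weight
      clause for \<open>N\<close> and \<open>N'\<close> follows from the one for the lifts, and
      fullness carries the vanishing over.\<close>
    have "\<not> isomorphic C (lift N) (lift N')" if "\<not> isomorphic D N N'"
      using that M FObj_isomorphic D.isomorphic_sym D.isomorphic_trans by blast
    then have "zero_Hom C (lift N) (lift N')"
      using w M zero C.brick_indecomposable unfolding wt'_def by blast
    then have "zero_Hom D (FObj F (lift N)) (FObj F (lift N'))"
      using full M by (intro full_zero_Hom) (auto simp: brick_def)
    then show ?thesis using M D.zero_Hom_isomorphic by blast
  qed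
  ultimately show ?thesis unfolding mixed_def by blast
qed

text \<open>The image of a self-dual brick is self-dual, because \<open>F\<close> commutes with the
  dualities; it is either a zero object or a brick.\<close>

lemma K0_map_orthodox_basis:
  assumes "b \<in> orthodox_basis C"
  shows "K0_map D F b \<in> orthodox_basis D \<or> K0_map D F b = \<zero>\<^bsub>K0 D\<^esub>"
proof -
  obtain P where P: "b = K0_class C P" "indecomposable C P" "isomorphic C (dual C P) P"
    using assms by (auto simp: C.orthodox_basis_eq)
  have b: "K0_map D F b = K0_class D (FObj F P)" unfolding P(1) by (rule K0_map_K0_class)
  show ?thesis
  proof (cases "zero_object D (FObj F P)")
    case True
    then show ?thesis using b D.zero_object_K0_class by (simp add: zero_K0)
  next
    case False
    have brick: "brick K C P" using P C.mixed_indecomposable_iff_brick[OF mixed_dom] by blast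
    then have "indecomposable D (FObj F P)"
      using full False full_brick D.brick_indecomposable by blast
    moreover have "isomorphic D (dual D (FObj F P)) (FObj F P)"
      using brick P FObj_Dual[of P] FObj_isomorphic D.isomorphic_sym D.isomorphic_trans
      unfolding brick_def by blast
    ultimately show ?thesis using b by (auto simp: D.orthodox_basis_eq)
  qed
qed

text \<open>A self-dual indecomposable is lifted to a brick, whose self-duality comes from
  uniqueness of lifts. Uniqueness of \<open>b\<close> first recovers the image object from its class
  and then the lift from its image.\<close>

lemma ex1_orthodox_preimage:
  assumes "b' \<in> orthodox_basis D"
  shows "\<exists>!b. b \<in> orthodox_basis C \<and> K0_map D F b = b'"
proof -
  obtain P where P: "b' = K0_class D P" "indecomposable D P" "isomorphic D (dual D P) P"
    using assms by (auto simp: D.orthodox_basis_eq)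
  obtain M where M: "brick K C M" "isomorphic D (FObj F M) P"
    using P(2) by (rule indecomposable_lift)
  \<comment> \<open>Both \<open>M\<close> and its dual lift the self-dual \<open>P\<close>.\<close>
  have "isomorphic D (FObj F (dual C M)) P"
    using M P FObj_Dual[of M] D.Dual_isomorphic D.isomorphic_trans unfolding brick_def by blast
  then have "isomorphic C (dual C M) M"
    using M P(2) C.Dual_brick bricks_isomorphic_if_image by blast
  then have "K0_class C M \<in> orthodox_basis C"
    using M C.brick_indecomposable by (auto simp: C.orthodox_basis_eq)
  moreover have "K0_map D F (K0_class C M) = b'"
    using M P D.isomorphic_K0_class[OF D.additive] by (simp add: K0_map_K0_class)
  moreover have "b = K0_class C M" if b: "b \<in> orthodox_basis C" "K0_map D F b = b'" for b
  proof -
    obtain Q where Q: "b = K0_class C Q" "indecomposable C Q"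
      using b by (auto simp: C.orthodox_basis_eq)
    then have bQ: "brick K C Q" using C.mixed_indecomposable_iff_brick[OF mixed_dom] by blast
    have eq: "K0_class D (FObj F Q) = K0_class D P"
      using b P Q by (simp add: K0_map_K0_class)
    then have "\<not> zero_object D (FObj F Q)"
      using D.indecomposable_K0_class_nonzero[OF P(2)] D.zero_object_K0_class by (auto simp: zero_K0)
    then have "indecomposable D (FObj F Q)"
      using full bQ full_brick D.brick_indecomposable by blast
    \<comment> \<open>Mixedness of the target is what allows equal classes to be turned into an
      isomorphism.\<close>
    then have "isomorphic D (FObj F Q) P"
      using P(2) eq mixed_cod D.mixed_K0_class_inj by blast
    then have "isomorphic C Q M" using M P(2) bQ bricks_isomorphic_if_image by blast
    then show ?thesis using Q C.isomorphic_K0_class[OF C.additive] by simp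
  qed
  ultimately show ?thesis by blast
qed

lemma zero_notin_orthodox_basis: "\<zero>\<^bsub>K0 D\<^esub> \<notin> orthodox_basis D"
  unfolding D.orthodox_basis_eq using D.indecomposable_K0_class_nonzero by fastforce

end

text \<open>The preimage of \<open>B\<close> is mapped bijectively, and every other element
  contributes a copy of \<open>z\<close>; \<open>z\<close> lying outside \<open>B\<close> makes the
  two parts disjoint. The number \<open>n\<close> counts the elements sent to
  \<open>z\<close>.\<close>

lemma image_mset_eq_mset_set_plus_replicate:
  assumes A: "finite A" and "z \<notin> B"
    and ex1: "\<And>b. b \<in> B \<Longrightarrow> \<exists>!a. a \<in> A \<and> f a = b"
    and z: "\<And>a. a \<in> A \<Longrightarrow> f a \<in> B \<or> f a = z"
  shows "\<exists>n. image_mset f (mset_set A) = mset_set B + replicate_mset n z"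
proof -
  let ?A = "{a \<in> A. f a \<in> B}" and ?Z = "{a \<in> A. f a = z}"
  have "bij_betw f ?A B"
    unfolding bij_betw_def inj_on_def using ex1 by blast
  then have "image_mset f (mset_set ?A) = mset_set B"
    by (simp add: image_mset_mset_set bij_betw_def)
  moreover have "image_mset f (mset_set ?Z) = image_mset (\<lambda>_. z) (mset_set ?Z)"
    using A by (intro image_mset_cong) auto
  moreover have "mset_set A = mset_set ?A + mset_set ?Z"
  proof -
    have "A = ?A \<union> ?Z" using z by blast
    then have "mset_set A = mset_set (?A \<union> ?Z)" by simp
    also have "\<dots> = mset_set ?A + mset_set ?Z"
      using A assms(2) by (intro mset_set_Union) auto
    finally show ?thesis .
  qed
  ultimately show ?thesis by (auto simp: image_mset_const_eq)
qed

theorem lemma1p15: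
  fixes K :: "'k ring"
    and C :: "('o, 'm, 'k) graded_data"
    and C' :: "('p, 'n, 'k) graded_data"
    and a :: "('o, 'm, 'p, 'n) functor_data"
  assumes "humorous_category K C"
    and "humorous_category K C'"
    and "linear_functor K C C' a"
    and "full_functor C C' a"
    and "essentially_surjective C C' a"
    and "naturally_isomorphic C C' (comp_functor a (Shift C)) (comp_functor (Shift C') a)"
    and "naturally_isomorphic (op_cat C) C'
           (comp_functor a (Dual C)) (comp_functor (Dual C') (op_functor a))"
    and "mixed K C"
  shows "mixed K C'
    \<and> (\<forall>b' \<in> orthodox_basis C'. \<exists>!b. b \<in> orthodox_basis C \<and> K0_map C' a b = b')
    \<and> (\<forall>b \<in> orthodox_basis C. K0_map C' a b \<notin> orthodox_basis C' \<longrightarrow> K0_map C' a b = \<zero>\<^bsub>K0 C'\<^esub>)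
    \<and> (\<exists>n. image_mset (K0_map C' a) (mset_set (orthodox_basis C))
             = mset_set (orthodox_basis C') + replicate_mset n \<zero>\<^bsub>K0 C'\<^esub>)"
proof -
  interpret humorous_quotient K C C' a
    using assms by (intro humorous_quotient.intro humorous_quotient_axioms.intro)
  show ?thesis
  proof (intro conjI ballI impI)
    show "\<exists>n. image_mset (K0_map C' a) (mset_set (orthodox_basis C))
        = mset_set (orthodox_basis C') + replicate_mset n \<zero>\<^bsub>K0 C'\<^esub>"
      using C.finite_orthodox_basis zero_notin_orthodox_basis ex1_orthodox_preimage
        K0_map_orthodox_basis by (rule image_mset_eq_mset_set_plus_replicate)
  qed (use mixed_cod ex1_orthodox_preimage K0_map_orthodox_basis in \<open>fast+\<close>)
qed

end
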